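(* Let $(\mathfrak{A},\mathfrak{A}_0)$ be a quasi *-algebra with unit $\mathsf{e}$, let $\mathcal{M}\subset\mathcal{I}_{\mathfrak{A}_0}(\mathfrak{A})$ be sufficient, and let $a\in\mathfrak{A}$. Then: (i) if $a\in\mathfrak{A}^{\mathcal{M}}_{\rm b}$, then $\pi(a)$ is a bounded operator for every $\mathcal{M}$-regular *-representation $\pi$ of $(\mathfrak{A},\mathfrak{A}_0)$, and $\|\pi(a)\|\le\|a\|^{\mathcal{M}}_{\rm b}$; (ii) if $\pi(a)$ is a bounded operator for every $\mathcal{M}$-regular *-representation $\pi$ of $(\mathfrak{A},\mathfrak{A}_0)$ and $\sup\{\|\pi(a)\|:\pi\ \mathcal{M}\text{-regular *-representation}\}<\infty$, then $a\in\mathfrak{A}^{\mathcal{M}}_{\rm b}$.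
   Context: Vector spaces are complex; sesquilinear forms and inner products are linear in the first variable. A quasi *-algebra $(\mathfrak{A},\mathfrak{A}_0)$ is a vector space $\mathfrak{A}$ with a *-algebra $\mathfrak{A}_0$ contained in $\mathfrak{A}$ as a subspace, such that: (i) $\mathfrak{A}$ carries an involution $a\mapsto a^*$ extending that of $\mathfrak{A}_0$; (ii) $\mathfrak{A}$ is a bimodule over $\mathfrak{A}_0$, with module multiplications extending the multiplication of $\mathfrak{A}_0$; in particular $(xa)y=x(ay)$ and $a(xy)=(ax)y$ for $a\in\mathfrak{A}$, $x,y\in\mathfrak{A}_0$; (iii) $(ax)^*=x^*a^*$ for $a\in\mathfrak{A}$, $x\in\mathfrak{A}_0$. A unit is an element $\mathsf{e}\in\mathfrak{A}_0$ with $a\mathsf{e}=\mathsf{e}a=a$ for all $a\in\mathfrak{A}$. $\mathcal{Q}_{\mathfrak{A}_0}(\mathfrak{A})$ is the set of sesquilinear forms $\varphi$ on $\mathfrak{A}\times\mathfrak{A}$ with $\varphi(a,a)\ge0$ for $a\in\mathfrak{A}$ and $\varphi(ax,y)=\varphi(x,a^*y)$ for $a\in\mathfrak{A}$, $x,y\in\mathfrak{A}_0$. For such $\varphi$, $N_\varphi=\{a:\varphi(a,a)=0\}$, $\lambda_\varphi:\mathfrak{A}\to\mathfrak{A}/N_\varphi$ is the quotient map, and $\mathcal{H}_\varphi$ is the Hilbert space completion of $\lambda_\varphi(\mathfrak{A})$ for $\langle\lambda_\varphi(a)|\lambda_\varphi(b)\rangle=\varphi(a,b)$. $\mathcal{I}_{\mathfrak{A}_0}(\mathfrak{A})$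 is the set of $\varphi\in\mathcal{Q}_{\mathfrak{A}_0}(\mathfrak{A})$ with $\lambda_\varphi(\mathfrak{A}_0)$ dense in $\mathcal{H}_\varphi$. For $x\in\mathfrak{A}_0$, $\varphi^x(a,b):=\varphi(ax,bx)$. A set $\mathcal{M}\subset\mathcal{I}_{\mathfrak{A}_0}(\mathfrak{A})$ is balanced if $\varphi\in\mathcal{M}$, $x\in\mathfrak{A}_0$ imply $\varphi^x\in\mathcal{M}$; it is sufficient if it is balanced and for every $a\in\mathfrak{A}\setminus\{0\}$ there is $\varphi\in\mathcal{M}$ with $\varphi(a,a)>0$. For a dense subspace $\mathcal{D}$ of a Hilbert space $\mathcal{H}$, $\mathcal{L}^\dagger(\mathcal{D},\mathcal{H})$ is the set of closable operators $X$ in $\mathcal{H}$ with domain $D(X)=\mathcal{D}$ and $D(X^* )\supset\mathcal{D}$; $X^\dagger:=X^*\upharpoonright\mathcal{D}$. The weak product $X_1\,\square\,X_2:=(X_1^\dagger)^*X_2$ is defined when $X_2\mathcal{D}\subset D((X_1^\dagger)^* )$ and $X_1^*\mathcal{D}\subset D(X_2^* )$. A *-representation $\pi$ of $(\mathfrak{A},\mathfrak{A}_0)$ is a linear map $\pi:\mathfrak{A}\to\mathcal{L}^\dagger(\mathcal{D}_\pi,\mathcal{H}_\pi)$, $\mathcal{D}_\pi$ a dense subspace of a Hilbert space $\mathcal{H}_\pi$, with $\pi(a^* )=\pi(a)^\dagger$ for $a\in\mathfrak{A}$, and, for $a\in\mathfrak{A}$, $x\in\mathfrak{A}_0$, $\pi(a)\,\square\,\pi(x)$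 well-defined and equal to $\pi(ax)$; if there is a unit, $\pi(\mathsf{e})$ is the identity of $\mathcal{D}_\pi$. $\pi$ is $\mathcal{M}$-regular if for every $\xi\in\mathcal{D}_\pi$ the form $\varphi_\xi(a,b)=\langle\pi(a)\xi|\pi(b)\xi\rangle$ belongs to $\mathcal{M}$. $\|\pi(a)\|$ is the operator norm of $\pi(a)$ on $\mathcal{D}_\pi$. $a\in\mathfrak{A}$ is $\mathcal{M}$-bounded if there is $\gamma_a>0$ with $|\varphi(ax,y)|\le\gamma_a\varphi(x,x)^{1/2}\varphi(y,y)^{1/2}$ for all $\varphi\in\mathcal{M}$, $x,y\in\mathfrak{A}_0$; $\|a\|^{\mathcal{M}}_{\rm b}$ is the infimum of such $\gamma_a$; $\mathfrak{A}^{\mathcal{M}}_{\rm b}$ is the set of $\mathcal{M}$-bounded elements. *)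

theory Defs
  imports Complex_Main
begin

section \<open>Quasi *-algebras\<close>

text \<open>
  The space \<open>\<AA>\<close> is the whole type \<open>'a\<close>, and \<open>core\<close> is the subspace \<open>\<AA>\<^sub>0\<close>. The two module
  multiplications are one total function \<open>mul\<close>; it is only meaningful, and only ever used, when
  at least one of its arguments lies in \<open>core\<close>.
\<close>

record 'a quasi_algebra =
  smul :: "complex \<Rightarrow> 'a \<Rightarrow> 'a"
  core :: "'a set"
  mul :: "'a \<Rightarrow> 'a \<Rightarrow> 'a"
  star :: "'a \<Rightarrow> 'a"

locale quasi_star_algebra =
  fixes Q :: "'a::ab_group_add quasi_algebra"
  assumes vector_space: "vector_space (smul Q)"
    and core_subspace: "module.subspace (smul Q) (core Q)"
    and core_mul: "\<lbrakk>x \<in> core Q; y \<in> core Q\<rbrakk> \<Longrightarrow> mul Q x y \<in> core Q"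
    and core_star: "x \<in> core Q \<Longrightarrow> star Q x \<in> core Q"
    and star_star: "star Q (star Q a) = a"
    and star_add: "star Q (a + b) = star Q a + star Q b"
    and star_smul: "star Q (smul Q c a) = smul Q (cnj c) (star Q a)"
    and mul_add_core: "\<lbrakk>x \<in> core Q; y \<in> core Q\<rbrakk> \<Longrightarrow> mul Q a (x + y) = mul Q a x + mul Q a y"
    and add_mul_core: "x \<in> core Q \<Longrightarrow> mul Q (a + b) x = mul Q a x + mul Q b x"
    and core_add_mul: "\<lbrakk>x \<in> core Q; y \<in> core Q\<rbrakk> \<Longrightarrow> mul Q (x + y) a = mul Q x a + mul Q y a"
    and core_mul_add: "x \<in> core Q \<Longrightarrow> mul Q x (a + b) = mul Q x a + mul Q x b"
    and smul_mul_core: "x \<in> core Q \<Longrightarrow> mul Q (smul Q c a) x = smul Q c (mul Q a x)"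
    and mul_smul_core: "x \<in> core Q \<Longrightarrow> mul Q a (smul Q c x) = smul Q c (mul Q a x)"
    and core_smul_mul: "x \<in> core Q \<Longrightarrow> mul Q (smul Q c x) a = smul Q c (mul Q x a)"
    and core_mul_smul: "x \<in> core Q \<Longrightarrow> mul Q x (smul Q c a) = smul Q c (mul Q x a)"
    and assoc_left: "\<lbrakk>x \<in> core Q; y \<in> core Q\<rbrakk> \<Longrightarrow> mul Q (mul Q x y) a = mul Q x (mul Q y a)"
    and assoc_right: "\<lbrakk>x \<in> core Q; y \<in> core Q\<rbrakk> \<Longrightarrow> mul Q a (mul Q x y) = mul Q (mul Q a x) y"
    and assoc_middle: "\<lbrakk>x \<in> core Q; y \<in> core Q\<rbrakk> \<Longrightarrow> mul Q (mul Q x a) y = mul Q x (mul Q a y)"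
    and star_mul: "x \<in> core Q \<Longrightarrow> star Q (mul Q a x) = mul Q (star Q x) (star Q a)"

definition is_unit_of :: "'a quasi_algebra \<Rightarrow> 'a \<Rightarrow> bool" where
  "is_unit_of Q e \<longleftrightarrow> e \<in> core Q \<and> (\<forall>a. mul Q a e = a \<and> mul Q e a = a)"


section \<open>Hilbert spaces with an explicit carrier\<close>

text \<open>
  Carriers are sets rather than types because the representations quantified over below act on
  different Hilbert spaces. Values of the operations outside the carrier are irrelevant.
\<close>

record 'h inner_space =
  vecs :: "'h set"
  vzero :: 'h
  vadd :: "'h \<Rightarrow> 'h \<Rightarrow> 'h"
  vscale :: "complex \<Rightarrow> 'h \<Rightarrow> 'h"
  vinner :: "'h \<Rightarrow> 'h \<Rightarrow> complex"

definition hnorm :: "'h inner_space \<Rightarrow> 'h \<Rightarrow> real" where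
  "hnorm H \<xi> = sqrt (Re (vinner H \<xi> \<xi>))"

definition hdist :: "'h inner_space \<Rightarrow> 'h \<Rightarrow> 'h \<Rightarrow> real" where
  "hdist H \<xi> \<eta> = hnorm H (vadd H \<xi> (vscale H (-1) \<eta>))"

locale hilbert_space =
  fixes H :: "'h inner_space"
  assumes zero_closed: "vzero H \<in> vecs H"
    and add_closed: "\<lbrakk>\<xi> \<in> vecs H; \<eta> \<in> vecs H\<rbrakk> \<Longrightarrow> vadd H \<xi> \<eta> \<in> vecs H"
    and scale_closed: "\<xi> \<in> vecs H \<Longrightarrow> vscale H c \<xi> \<in> vecs H"
    and add_assoc: "\<lbrakk>\<xi> \<in> vecs H; \<eta> \<in> vecs H; \<zeta> \<in> vecs H\<rbrakk>
          \<Longrightarrow> vadd H (vadd H \<xi> \<eta>) \<zeta> = vadd H \<xi> (vadd H \<eta> \<zeta>)"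
    and add_commute: "\<lbrakk>\<xi> \<in> vecs H; \<eta> \<in> vecs H\<rbrakk> \<Longrightarrow> vadd H \<xi> \<eta> = vadd H \<eta> \<xi>"
    and add_zero: "\<xi> \<in> vecs H \<Longrightarrow> vadd H \<xi> (vzero H) = \<xi>"
    and add_inverse: "\<xi> \<in> vecs H \<Longrightarrow> \<exists>\<eta>\<in>vecs H. vadd H \<xi> \<eta> = vzero H"
    and scale_add_right: "\<lbrakk>\<xi> \<in> vecs H; \<eta> \<in> vecs H\<rbrakk>
          \<Longrightarrow> vscale H c (vadd H \<xi> \<eta>) = vadd H (vscale H c \<xi>) (vscale H c \<eta>)"
    and scale_add_left: "\<xi> \<in> vecs H \<Longrightarrow> vscale H (c + d) \<xi> = vadd H (vscale H c \<xi>) (vscale H d \<xi>)"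
    and scale_scale: "\<xi> \<in> vecs H \<Longrightarrow> vscale H c (vscale H d \<xi>) = vscale H (c * d) \<xi>"
    and scale_one: "\<xi> \<in> vecs H \<Longrightarrow> vscale H 1 \<xi> = \<xi>"
    and inner_add: "\<lbrakk>\<xi> \<in> vecs H; \<eta> \<in> vecs H; \<zeta> \<in> vecs H\<rbrakk>
          \<Longrightarrow> vinner H (vadd H \<xi> \<eta>) \<zeta> = vinner H \<xi> \<zeta> + vinner H \<eta> \<zeta>"
    and inner_scale: "\<lbrakk>\<xi> \<in> vecs H; \<eta> \<in> vecs H\<rbrakk> \<Longrightarrow> vinner H (vscale H c \<xi>) \<eta> = c * vinner H \<xi> \<eta>"
    and inner_commute: "\<lbrakk>\<xi> \<in> vecs H; \<eta> \<in> vecs H\<rbrakk> \<Longrightarrow> vinner H \<eta> \<xi> = cnj (vinner H \<xi> \<eta>)"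
    and inner_nonneg: "\<xi> \<in> vecs H \<Longrightarrow> 0 \<le> Re (vinner H \<xi> \<xi>)"
    and inner_definite: "\<lbrakk>\<xi> \<in> vecs H; vinner H \<xi> \<xi> = 0\<rbrakk> \<Longrightarrow> \<xi> = vzero H"
    and complete: "\<lbrakk>\<And>n. s n \<in> vecs H;
            \<forall>\<epsilon>>0. \<exists>N. \<forall>m\<ge>N. \<forall>n\<ge>N. hdist H (s m) (s n) < \<epsilon>\<rbrakk>
          \<Longrightarrow> \<exists>\<xi>\<in>vecs H. (\<lambda>n::nat. hdist H (s n) \<xi>) \<longlonglongrightarrow> 0"

definition hsubspace :: "'h inner_space \<Rightarrow> 'h set \<Rightarrow> bool" where
  "hsubspace H D \<longleftrightarrow> D \<subseteq> vecs H \<and> vzero H \<in> D \<and>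
     (\<forall>\<xi>\<in>D. \<forall>\<eta>\<in>D. vadd H \<xi> \<eta> \<in> D) \<and> (\<forall>c. \<forall>\<xi>\<in>D. vscale H c \<xi> \<in> D)"

definition hdense :: "'h inner_space \<Rightarrow> 'h set \<Rightarrow> bool" where
  "hdense H D \<longleftrightarrow> D \<subseteq> vecs H \<and> (\<forall>\<xi>\<in>vecs H. \<forall>\<epsilon>>0. \<exists>\<eta>\<in>D. hdist H \<xi> \<eta> < \<epsilon>)"


section \<open>Unbounded operators\<close>

text \<open>
  An operator is a partial function \<open>'h \<rightharpoonup> 'h\<close>, so equality of operators includes equality of
  their domains.
\<close>

definition linear_operator :: "'h inner_space \<Rightarrow> ('h \<rightharpoonup> 'h) \<Rightarrow> bool" where
  "linear_operator H X \<longleftrightarrow> hsubspace H (dom X) \<and> ran X \<subseteq> vecs H \<and>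
     (\<forall>\<xi>\<in>dom X. \<forall>\<eta>\<in>dom X. the (X (vadd H \<xi> \<eta>)) = vadd H (the (X \<xi>)) (the (X \<eta>))) \<and>
     (\<forall>c. \<forall>\<xi>\<in>dom X. the (X (vscale H c \<xi>)) = vscale H c (the (X \<xi>)))"

definition closable :: "'h inner_space \<Rightarrow> ('h \<rightharpoonup> 'h) \<Rightarrow> bool" where
  "closable H X \<longleftrightarrow> (\<forall>(s :: nat \<Rightarrow> 'h) \<eta>.
     (\<forall>n. s n \<in> dom X) \<and> \<eta> \<in> vecs H \<and> (\<lambda>n. hnorm H (s n)) \<longlonglongrightarrow> 0 \<and>
     (\<lambda>n. hdist H (the (X (s n))) \<eta>) \<longlonglongrightarrow> 0 \<longrightarrow> \<eta> = vzero H)"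

text \<open>The vector \<open>\<zeta>\<close> below is unique when \<open>X\<close> is densely defined, the only case of interest.\<close>

definition adjoint :: "'h inner_space \<Rightarrow> ('h \<rightharpoonup> 'h) \<Rightarrow> ('h \<rightharpoonup> 'h)" where
  "adjoint H X = (\<lambda>\<eta>.
     if \<eta> \<in> vecs H \<and> (\<exists>\<zeta>\<in>vecs H. \<forall>\<xi>\<in>dom X. vinner H (the (X \<xi>)) \<eta> = vinner H \<xi> \<zeta>)
     then Some (THE \<zeta>. \<zeta> \<in> vecs H \<and> (\<forall>\<xi>\<in>dom X. vinner H (the (X \<xi>)) \<eta> = vinner H \<xi> \<zeta>))
     else None)"

definition L_dagger :: "'h inner_space \<Rightarrow> 'h set \<Rightarrow> ('h \<rightharpoonup> 'h) set" where
  "L_dagger H D =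
     {X. linear_operator H X \<and> closable H X \<and> dom X = D \<and> D \<subseteq> dom (adjoint H X)}"

definition dagger :: "'h inner_space \<Rightarrow> ('h \<rightharpoonup> 'h) \<Rightarrow> ('h \<rightharpoonup> 'h)" where
  "dagger H X = adjoint H X |` dom X"

definition weak_product_defined ::
    "'h inner_space \<Rightarrow> 'h set \<Rightarrow> ('h \<rightharpoonup> 'h) \<Rightarrow> ('h \<rightharpoonup> 'h) \<Rightarrow> bool" where
  "weak_product_defined H D X\<^sub>1 X\<^sub>2 \<longleftrightarrow>
     (\<forall>\<xi>\<in>D. the (X\<^sub>2 \<xi>) \<in> dom (adjoint H (dagger H X\<^sub>1))) \<and>
     (\<forall>\<xi>\<in>D. the (adjoint H X\<^sub>1 \<xi>) \<in> dom (adjoint H X\<^sub>2))"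

definition weak_product ::
    "'h inner_space \<Rightarrow> ('h \<rightharpoonup> 'h) \<Rightarrow> ('h \<rightharpoonup> 'h) \<Rightarrow> ('h \<rightharpoonup> 'h)" where
  "weak_product H X\<^sub>1 X\<^sub>2 = adjoint H (dagger H X\<^sub>1) \<circ>\<^sub>m X\<^sub>2"

definition bounded_operator :: "'h inner_space \<Rightarrow> ('h \<rightharpoonup> 'h) \<Rightarrow> bool" where
  "bounded_operator H X \<longleftrightarrow> (\<exists>C. \<forall>\<xi>\<in>dom X. hnorm H (the (X \<xi>)) \<le> C * hnorm H \<xi>)"

text \<open>The real supremum is the operator norm only if \<open>bounded_operator H X\<close> holds.\<close>

definition operator_norm :: "'h inner_space \<Rightarrow> ('h \<rightharpoonup> 'h) \<Rightarrow> real" where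
  "operator_norm H X = Sup {hnorm H (the (X \<xi>)) | \<xi>. \<xi> \<in> dom X \<and> hnorm H \<xi> \<le> 1}"


section \<open>Positive sesquilinear forms and their Hilbert spaces\<close>

type_synonym 'a form = "'a \<Rightarrow> 'a \<Rightarrow> complex"

definition sesquilinear :: "'a::ab_group_add quasi_algebra \<Rightarrow> 'a form \<Rightarrow> bool" where
  "sesquilinear Q \<phi> \<longleftrightarrow>
     (\<forall>a b c. \<phi> (a + b) c = \<phi> a c + \<phi> b c) \<and> (\<forall>k a b. \<phi> (smul Q k a) b = k * \<phi> a b) \<and>
     (\<forall>a b c. \<phi> a (b + c) = \<phi> a b + \<phi> a c) \<and> (\<forall>k a b. \<phi> a (smul Q k b) = cnj k * \<phi> a b)"

definition Q_forms :: "'a::ab_group_add quasi_algebra \<Rightarrow> 'a form set" where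
  "Q_forms Q = {\<phi>. sesquilinear Q \<phi> \<and> (\<forall>a. Im (\<phi> a a) = 0 \<and> 0 \<le> Re (\<phi> a a)) \<and>
     (\<forall>a. \<forall>x\<in>core Q. \<forall>y\<in>core Q. \<phi> (mul Q a x) y = \<phi> x (mul Q (star Q a) y))}"

definition form_norm :: "'a form \<Rightarrow> 'a \<Rightarrow> real" where
  "form_norm \<phi> a = sqrt (Re (\<phi> a a))"

text \<open>
  \<open>\<H>\<^sub>\<phi>\<close> is built from Cauchy sequences in \<open>\<AA>\<close> for the seminorm of \<open>\<phi>\<close>, modulo sequences
  converging to \<open>0\<close>. This divides out \<open>N\<^sub>\<phi>\<close> and completes in one step: \<open>\<lambda>\<^sub>\<phi> a\<close> is the
  class of the constant sequence \<open>a\<close>, so that \<open>\<lambda>\<^sub>\<phi> a = \<lambda>\<^sub>\<phi> b\<close> iff \<open>a - b \<in> N\<^sub>\<phi>\<close>, and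
  \<open>\<AA>/N\<^sub>\<phi>\<close> is identified with the range of \<open>\<lambda>\<^sub>\<phi>\<close>.
\<close>

type_synonym 'a completion_vec = "(nat \<Rightarrow> 'a) set"

definition form_Cauchy :: "'a::ab_group_add form \<Rightarrow> (nat \<Rightarrow> 'a) \<Rightarrow> bool" where
  "form_Cauchy \<phi> s \<longleftrightarrow> (\<forall>\<epsilon>>0. \<exists>N. \<forall>m\<ge>N. \<forall>n\<ge>N. form_norm \<phi> (s m - s n) < \<epsilon>)"

definition form_rel :: "'a::ab_group_add form \<Rightarrow> ((nat \<Rightarrow> 'a) \<times> (nat \<Rightarrow> 'a)) set" where
  "form_rel \<phi> = {(s, t). form_Cauchy \<phi> s \<and> form_Cauchy \<phi> t \<and>
     (\<lambda>n. form_norm \<phi> (s n - t n)) \<longlonglongrightarrow> 0}"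

definition form_class :: "'a::ab_group_add form \<Rightarrow> (nat \<Rightarrow> 'a) \<Rightarrow> 'a completion_vec" where
  "form_class \<phi> s = form_rel \<phi> `` {s}"

definition form_rep :: "'a completion_vec \<Rightarrow> nat \<Rightarrow> 'a" where
  "form_rep S = (SOME s. s \<in> S)"

definition form_space :: "'a::ab_group_add quasi_algebra \<Rightarrow> 'a form \<Rightarrow> 'a completion_vec inner_space"
  where "form_space Q \<phi> =
    \<lparr>vecs = {s. form_Cauchy \<phi> s} // form_rel \<phi>,
     vzero = form_class \<phi> (\<lambda>n. 0),
     vadd = (\<lambda>S T. form_class \<phi> (\<lambda>n. form_rep S n + form_rep T n)),
     vscale = (\<lambda>c S. form_class \<phi> (\<lambda>n. smul Q c (form_rep S n))),
     vinner = (\<lambda>S T. lim (\<lambda>n. \<phi> (form_rep S n) (form_rep T n)))\<rparr>"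

definition form_vec :: "'a::ab_group_add form \<Rightarrow> 'a \<Rightarrow> 'a completion_vec" where
  "form_vec \<phi> a = form_class \<phi> (\<lambda>n. a)"

definition I_forms :: "'a::ab_group_add quasi_algebra \<Rightarrow> 'a form set" where
  "I_forms Q = {\<phi> \<in> Q_forms Q. hdense (form_space Q \<phi>) (form_vec \<phi> ` core Q)}"

definition form_shift :: "'a quasi_algebra \<Rightarrow> 'a form \<Rightarrow> 'a \<Rightarrow> 'a form" where
  "form_shift Q \<phi> x = (\<lambda>a b. \<phi> (mul Q a x) (mul Q b x))"

definition balanced :: "'a quasi_algebra \<Rightarrow> 'a form set \<Rightarrow> bool" where
  "balanced Q M \<longleftrightarrow> (\<forall>\<phi>\<in>M. \<forall>x\<in>core Q. form_shift Q \<phi> x \<in> M)"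

definition sufficient :: "'a::ab_group_add quasi_algebra \<Rightarrow> 'a form set \<Rightarrow> bool" where
  "sufficient Q M \<longleftrightarrow> balanced Q M \<and> (\<forall>a. a \<noteq> 0 \<longrightarrow> (\<exists>\<phi>\<in>M. 0 < Re (\<phi> a a)))"


section \<open>Bounded elements and regular representations\<close>

definition form_bounds :: "'a quasi_algebra \<Rightarrow> 'a form set \<Rightarrow> 'a \<Rightarrow> real set" where
  "form_bounds Q M a = {\<gamma>. 0 < \<gamma> \<and> (\<forall>\<phi>\<in>M. \<forall>x\<in>core Q. \<forall>y\<in>core Q.
     cmod (\<phi> (mul Q a x) y) \<le> \<gamma> * sqrt (Re (\<phi> x x)) * sqrt (Re (\<phi> y y)))}"

definition bounded_elements :: "'a quasi_algebra \<Rightarrow> 'a form set \<Rightarrow> 'a set" where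
  "bounded_elements Q M = {a. form_bounds Q M a \<noteq> {}}"

definition bounded_norm :: "'a quasi_algebra \<Rightarrow> 'a form set \<Rightarrow> 'a \<Rightarrow> real" where
  "bounded_norm Q M a = Inf (form_bounds Q M a)"

definition star_representation ::
    "'a::ab_group_add quasi_algebra \<Rightarrow> 'h inner_space \<Rightarrow> 'h set \<Rightarrow> ('a \<Rightarrow> 'h \<rightharpoonup> 'h) \<Rightarrow> bool" where
  "star_representation Q H D \<pi> \<longleftrightarrow>
     hilbert_space H \<and> hsubspace H D \<and> hdense H D \<and>
     (\<forall>a. \<pi> a \<in> L_dagger H D) \<and>
     (\<forall>a b. \<forall>\<xi>\<in>D. the (\<pi> (a + b) \<xi>) = vadd H (the (\<pi> a \<xi>)) (the (\<pi> b \<xi>))) \<and>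
     (\<forall>c a. \<forall>\<xi>\<in>D. the (\<pi> (smul Q c a) \<xi>) = vscale H c (the (\<pi> a \<xi>))) \<and>
     (\<forall>a. \<pi> (star Q a) = dagger H (\<pi> a)) \<and>
     (\<forall>a. \<forall>x\<in>core Q. weak_product_defined H D (\<pi> a) (\<pi> x) \<and>
        weak_product H (\<pi> a) (\<pi> x) = \<pi> (mul Q a x)) \<and>
     (\<forall>e. is_unit_of Q e \<longrightarrow> \<pi> e = Some |` D)"

definition regular_representation ::
    "'a::ab_group_add quasi_algebra \<Rightarrow> 'a form set \<Rightarrow> 'h inner_space \<Rightarrow> 'h set \<Rightarrow>
     ('a \<Rightarrow> 'h \<rightharpoonup> 'h) \<Rightarrow> bool" where
  "regular_representation Q M H D \<pi> \<longleftrightarrow> star_representation Q H D \<pi> \<and>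
     (\<forall>\<xi>\<in>D. (\<lambda>a b. vinner H (the (\<pi> a \<xi>)) (the (\<pi> b \<xi>))) \<in> M)"

text \<open>
  HOL cannot quantify over all carrier types inside a formula. A conclusion about every regular
  representation is therefore stated for an arbitrary type \<open>'h\<close>. A hypothesis about every
  regular representation is required only for Hilbert spaces whose carrier is a set of elements
  of \<open>'a completion_vec\<close>, the type in which all the spaces \<open>\<H>\<^sub>\<phi>\<close> live. This is a weaker
  hypothesis than the one over all Hilbert spaces, so the resulting implication is at least as
  strong.
\<close>

end

theory Submission
  imports Defs
begin

text \<open>
  The two directions compare \<open>\<M>\<close>-boundedness with operator bounds through the forms
  \<open>\<phi>\<^sub>\<xi>(a, b) = \<langle>\<pi>(a)\<xi> | \<pi>(b)\<xi>\<rangle>\<close> and through the GNS construction.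

  Let \<open>\<gamma>\<close> be an \<open>\<M>\<close>-bound of \<open>a\<close> and \<open>\<xi>\<close> a vector in the domain of an \<open>\<M>\<close>-regular
  representation \<open>\<pi>\<close>. Since \<open>\<phi> = \<phi>\<^sub>\<xi>\<close> is in \<open>\<M>\<close> and \<open>\<pi>(e)\<xi> = \<xi>\<close>, the choice \<open>x = e\<close> in the
  definition of boundedness gives \<open>\<bar>\<phi>(a, y)\<bar> \<le> \<gamma> \<parallel>\<xi>\<parallel> \<phi>(y, y)\<^bsup>1/2\<^esup>\<close> for all \<open>y\<close> in \<open>\<AA>\<^sub>0\<close>. This
  bounds a functional on the dense subspace \<open>\<lambda>\<^sub>\<phi>(\<AA>\<^sub>0)\<close>, so \<open>y\<close> may be replaced by \<open>a\<close> itself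
  (\<open>N_le_if_core_bound\<close>), and \<open>\<parallel>\<pi>(a)\<xi>\<parallel> = \<phi>(a, a)\<^bsup>1/2\<^esup> \<le> \<gamma> \<parallel>\<xi>\<parallel>\<close>. Taking the infimum over
  \<open>\<gamma>\<close> gives the norm inequality.

  Conversely, every \<open>\<phi> \<in> \<M>\<close> induces a representation \<open>\<lambda>\<^sub>\<phi>(x) \<mapsto> \<lambda>\<^sub>\<phi>(a x)\<close> on \<open>\<lambda>\<^sub>\<phi>(\<AA>\<^sub>0)\<close>. The
  form belonging to its vector \<open>\<lambda>\<^sub>\<phi>(x)\<close> is \<open>\<phi>\<^sup>x\<close>, so the representation is \<open>\<M>\<close>-regular because
  \<open>\<M>\<close> is balanced (\<open>regular_representation_rep\<close>). A bound \<open>C\<close> on the norms of \<open>\<pi>(a)\<close>, common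
  to all \<open>\<M>\<close>-regular representations, then yields
  \<open>\<bar>\<phi>(a x, y)\<bar> \<le> C \<phi>(x, x)\<^bsup>1/2\<^esup> \<phi>(y, y)\<^bsup>1/2\<^esup>\<close> by the Cauchy--Schwarz inequality.

  The completion by Cauchy sequences is a Hilbert space (\<open>hilbert_space_form_space\<close>), and the
  induced operators belong to \<open>\<L>\<^sup>\<dagger>\<close> because all statements about their adjoints reduce to
  identities for \<open>\<phi>\<close> on \<open>\<AA>\<^sub>0\<close> once \<open>\<lambda>\<^sub>\<phi>(\<AA>\<^sub>0)\<close> is dense.
\<close>


section \<open>The Cauchy--Schwarz inequality\<close>

text \<open>
  The polynomial argument behind the Cauchy--Schwarz inequality, isolated because it is applied
  both to positive forms on a vector space and to inner products on a carrier set.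
\<close>

lemma discriminant_bound:
  fixes A C :: real and b :: complex
  assumes A: "0 \<le> A" and C: "0 \<le> C"
    and nonneg: "\<And>k. 0 \<le> A + 2 * Re (k * b) + (cmod k)\<^sup>2 * C"
  shows "cmod b \<le> sqrt A * sqrt C"
proof -
  have quadratic: "0 \<le> A - 2 * t * (cmod b)\<^sup>2 + t\<^sup>2 * (cmod b)\<^sup>2 * C" for t :: real
  proof -
    have "Re (- (of_real t * cnj b) * b) = - t * (cmod b)\<^sup>2"
      unfolding cmod_power2 by (simp add: power2_eq_square algebra_simps)
    moreover have "(cmod (- (of_real t * cnj b)))\<^sup>2 = t\<^sup>2 * (cmod b)\<^sup>2"
      by (simp add: norm_mult power_mult_distrib)
    ultimately show ?thesis
      using nonneg[of "- (of_real t * cnj b)"] by simp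
  qed
  \<comment> \<open>The minimum over \<open>t\<close> is at \<open>1 / C\<close>; if \<open>C = 0\<close> the bound is linear in \<open>t\<close>, and a large
    enough \<open>t\<close> makes it negative unless \<open>b = 0\<close>.\<close>
  have "(cmod b)\<^sup>2 \<le> A * C"
  proof (cases "C = 0")
    case True
    show ?thesis
    proof (rule ccontr)
      assume "\<not> ?thesis"
      then have "0 < (cmod b)\<^sup>2" using True by simp
      then show False
        using quadratic[of "(A + 1) / (2 * (cmod b)\<^sup>2)"] True by simp
    qed
  next
    case False
    then have "0 < C" using C by simp
    moreover have "0 \<le> A - (cmod b)\<^sup>2 / C"
      using quadratic[of "1 / C"] False by (simp add: power2_eq_square field_simps)
    ultimately show ?thesis by (simp add: field_simps)
  qed
  then have "sqrt ((cmod b)\<^sup>2) \<le> sqrt (A * C)" by (rule real_sqrt_le_mono)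
  then show ?thesis by (simp add: real_sqrt_mult)
qed


lemma tendsto_zero_comparison:
  fixes f :: "nat \<Rightarrow> 'b::real_normed_vector"
  assumes "\<And>n. norm (f n) \<le> g n" "g \<longlonglongrightarrow> 0"
  shows "f \<longlonglongrightarrow> 0"
  by (rule tendsto_0_le[OF assms(2), of _ 1])
    (use order_trans[OF assms(1) abs_ge_self] in simp)


section \<open>Hilbert spaces and adjoints\<close>

context hilbert_space
begin

abbreviation vdiff where "vdiff \<xi> \<eta> \<equiv> vadd H \<xi> (vscale H (-1) \<eta>)"

lemma inner_add_right:
  assumes "\<xi> \<in> vecs H" "\<eta> \<in> vecs H" "\<zeta> \<in> vecs H"
  shows "vinner H \<zeta> (vadd H \<xi> \<eta>) = vinner H \<zeta> \<xi> + vinner H \<zeta> \<eta>"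
  using assms inner_commute[of "vadd H \<xi> \<eta>" \<zeta>] inner_commute[of \<xi> \<zeta>] inner_commute[of \<eta> \<zeta>]
  by (simp add: inner_add add_closed)

lemma inner_scale_right:
  assumes "\<xi> \<in> vecs H" "\<eta> \<in> vecs H"
  shows "vinner H \<xi> (vscale H c \<eta>) = cnj c * vinner H \<xi> \<eta>"
  using assms inner_commute[of "vscale H c \<eta>" \<xi>] inner_commute[of \<eta> \<xi>]
  by (simp add: inner_scale scale_closed)

lemma inner_self_real:
  assumes "\<xi> \<in> vecs H"
  shows "vinner H \<xi> \<xi> = of_real ((hnorm H \<xi>)\<^sup>2)"
proof -
  have "Im (vinner H \<xi> \<xi>) = 0"
    using inner_commute[OF assms assms] by (metis complex_cnj complex.sel(2) neg_equal_zero complex_surj)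
  then show ?thesis
    using inner_nonneg[OF assms] by (simp add: hnorm_def complex_eq_iff)
qed

lemma inner_bound:
  assumes \<xi>: "\<xi> \<in> vecs H" and \<eta>: "\<eta> \<in> vecs H"
  shows "cmod (vinner H \<xi> \<eta>) \<le> hnorm H \<xi> * hnorm H \<eta>"
proof -
  have "cmod (vinner H \<eta> \<xi>) \<le> sqrt (Re (vinner H \<xi> \<xi>)) * sqrt (Re (vinner H \<eta> \<eta>))"
  proof (rule discriminant_bound)
    fix k
    have "0 \<le> Re (vinner H (vadd H \<xi> (vscale H k \<eta>)) (vadd H \<xi> (vscale H k \<eta>)))"
      using assms by (intro inner_nonneg add_closed scale_closed)
    also have "\<dots> = Re (vinner H \<xi> \<xi> + k * vinner H \<eta> \<xi> + cnj (k * vinner H \<eta> \<xi>)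
        + k * cnj k * vinner H \<eta> \<eta>)"
      using assms inner_commute[OF \<eta> \<xi>]
      by (simp add: inner_add inner_add_right inner_scale inner_scale_right add_closed
          scale_closed algebra_simps)
    also have "\<dots> = Re (vinner H \<xi> \<xi>) + 2 * Re (k * vinner H \<eta> \<xi>)
        + (cmod k)\<^sup>2 * Re (vinner H \<eta> \<eta>)"
      unfolding complex_norm_square[symmetric] by (simp add: inner_self_real \<eta>)
    finally show "0 \<le> \<dots>" .
  qed (use assms in \<open>auto intro: inner_nonneg\<close>)
  then show ?thesis
    using inner_commute[OF \<eta> \<xi>] by (simp add: hnorm_def)
qed

lemma minus_self:
  assumes "\<xi> \<in> vecs H"
  shows "vdiff \<xi> \<xi> = vzero H"
proof (rule inner_definite)
  show "vdiff \<xi> \<xi> \<in> vecs H" using assms by (intro add_closed scale_closed)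
  show "vinner H (vdiff \<xi> \<xi>) (vdiff \<xi> \<xi>) = 0"
    using assms by (simp add: inner_add inner_scale add_closed scale_closed)
qed

lemma minus_eq_zero:
  assumes \<xi>: "\<xi> \<in> vecs H" and \<eta>: "\<eta> \<in> vecs H" and eq: "vdiff \<xi> \<eta> = vzero H"
  shows "\<xi> = \<eta>"
proof -
  have n: "vscale H (-1) \<eta> \<in> vecs H" using \<eta> by (rule scale_closed)
  have "\<xi> = vadd H \<xi> (vdiff \<eta> \<eta>)" using minus_self[OF \<eta>] add_zero[OF \<xi>] by simp
  also have "\<dots> = vadd H (vdiff \<xi> \<eta>) \<eta>"
    using add_assoc[OF \<xi> n \<eta>] add_commute[OF \<eta> n] by simp
  also have "\<dots> = \<eta>" using eq add_commute[OF zero_closed \<eta>] add_zero[OF \<eta>] by simp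
  finally show ?thesis .
qed

text \<open>
  If \<open>\<zeta> \<noteq> 0\<close>, a vector \<open>\<xi>\<close> of \<open>D\<close> at distance less than \<open>\<parallel>\<zeta>\<parallel>\<close> from \<open>\<zeta>\<close> would give
  \<open>\<parallel>\<zeta>\<parallel>\<^sup>2 = \<langle>\<zeta> - \<xi> | \<zeta>\<rangle> < \<parallel>\<zeta>\<parallel>\<^sup>2\<close>.
\<close>

lemma orthogonal_to_dense:
  assumes D: "hdense H D" and \<zeta>: "\<zeta> \<in> vecs H"
    and orth: "\<And>\<xi>. \<xi> \<in> D \<Longrightarrow> vinner H \<xi> \<zeta> = 0"
  shows "\<zeta> = vzero H"
proof (rule inner_definite[OF \<zeta>])
  have "hnorm H \<zeta> = 0"
  proof (rule ccontr)
    assume "hnorm H \<zeta> \<noteq> 0"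
    then have pos: "0 < hnorm H \<zeta>"
      using inner_nonneg[OF \<zeta>] by (simp add: hnorm_def)
    then obtain \<xi> where \<xi>: "\<xi> \<in> D" "\<xi> \<in> vecs H" and close: "hdist H \<zeta> \<xi> < hnorm H \<zeta>"
      using D \<zeta> unfolding hdense_def by (meson subsetD)
    have "vinner H \<zeta> \<zeta> = vinner H (vdiff \<zeta> \<xi>) \<zeta>"
      using \<xi> \<zeta> orth by (simp add: inner_add inner_scale scale_closed)
    then have "(hnorm H \<zeta>)\<^sup>2 = cmod (vinner H (vdiff \<zeta> \<xi>) \<zeta>)"
      using inner_self_real[OF \<zeta>] by (metis norm_of_real abs_power2)
    also have "\<dots> \<le> hdist H \<zeta> \<xi> * hnorm H \<zeta>"
      unfolding hdist_def using \<xi> \<zeta> by (intro inner_bound add_closed scale_closed)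
    also have "\<dots> < (hnorm H \<zeta>)\<^sup>2"
      using close pos by (simp add: power2_eq_square)
    finally show False by simp
  qed
  then show "vinner H \<zeta> \<zeta> = 0" using inner_self_real[OF \<zeta>] by simp
qed

text \<open>Density of the domain is what makes the definite description in the adjoint meaningful.\<close>

lemma adjoint_eqI:
  assumes D: "hdense H (dom X)" and ran: "ran X \<subseteq> vecs H"
    and \<eta>: "\<eta> \<in> vecs H" and \<zeta>: "\<zeta> \<in> vecs H"
    and eq: "\<And>\<xi>. \<xi> \<in> dom X \<Longrightarrow> vinner H (the (X \<xi>)) \<eta> = vinner H \<xi> \<zeta>"
  shows "adjoint H X \<eta> = Some \<zeta>"
proof -
  have "\<zeta>' = \<zeta>" if \<zeta>': "\<zeta>' \<in> vecs H"
    and eq': "\<forall>\<xi>\<in>dom X. vinner H (the (X \<xi>)) \<eta> = vinner H \<xi> \<zeta>'" for \<zeta>'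
  proof (rule minus_eq_zero[OF \<zeta>' \<zeta>], rule orthogonal_to_dense[OF D])
    show "vdiff \<zeta>' \<zeta> \<in> vecs H" using \<zeta> \<zeta>' by (intro add_closed scale_closed)
    fix \<xi> assume \<xi>: "\<xi> \<in> dom X"
    then have "\<xi> \<in> vecs H" using D by (auto simp: hdense_def)
    then show "vinner H \<xi> (vdiff \<zeta>' \<zeta>) = 0"
      using \<zeta> \<zeta>' eq[OF \<xi>] eq' \<xi>
      by (simp add: inner_add_right inner_scale_right scale_closed)
  qed
  then have "(THE \<zeta>. \<zeta> \<in> vecs H \<and> (\<forall>\<xi>\<in>dom X. vinner H (the (X \<xi>)) \<eta> = vinner H \<xi> \<zeta>)) = \<zeta>"
    using \<zeta> eq by (intro the_equality) auto
  then show ?thesis using \<eta> \<zeta> eq by (auto simp: adjoint_def)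
qed

text \<open>
  An operator with a densely defined formal adjoint \<open>Y\<close> is closable: if \<open>s n \<rightarrow> 0\<close> and
  \<open>X (s n) \<rightarrow> \<eta>\<close>, then \<open>\<langle>X (s n) | \<zeta>\<rangle> = \<langle>s n | Y \<zeta>\<rangle> \<rightarrow> 0\<close> shows that \<open>\<eta>\<close> is
  orthogonal to the domain of \<open>Y\<close>.
\<close>

lemma closable_if_formal_adjoint:
  assumes X: "dom X \<subseteq> vecs H" "ran X \<subseteq> vecs H"
    and D: "hdense H D" and Y: "\<And>\<zeta>. \<zeta> \<in> D \<Longrightarrow> Y \<zeta> \<in> vecs H"
    and eq: "\<And>\<xi> \<zeta>. \<xi> \<in> dom X \<Longrightarrow> \<zeta> \<in> D \<Longrightarrow> vinner H (the (X \<xi>)) \<zeta> = vinner H \<xi> (Y \<zeta>)"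
  shows "closable H X"
  unfolding closable_def
proof (intro allI impI, elim conjE)
  fix s :: "nat \<Rightarrow> 'h" and \<eta>
  assume s: "\<forall>n. s n \<in> dom X" and \<eta>: "\<eta> \<in> vecs H"
    and s0: "(\<lambda>n. hnorm H (s n)) \<longlonglongrightarrow> 0"
    and Xs: "(\<lambda>n. hdist H (the (X (s n))) \<eta>) \<longlonglongrightarrow> 0"
  have in_H: "s n \<in> vecs H" "the (X (s n)) \<in> vecs H" for n
    using s X by (auto simp: ran_def subset_iff) (metis domD option.sel)
  show "\<eta> = vzero H"
  proof (rule orthogonal_to_dense[OF D \<eta>])
    fix \<zeta> assume "\<zeta> \<in> D"
    then have \<zeta>: "\<zeta> \<in> vecs H" using D by (auto simp: hdense_def)
    have bound: "cmod (vinner H \<eta> \<zeta>)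
        \<le> hnorm H (s n) * hnorm H (Y \<zeta>) + hdist H (the (X (s n))) \<eta> * hnorm H \<zeta>" for n
    proof -
      have "vinner H \<eta> \<zeta> = vinner H (s n) (Y \<zeta>) - vinner H (vdiff (the (X (s n))) \<eta>) \<zeta>"
        using eq[of "s n" \<zeta>] s \<open>\<zeta> \<in> D\<close> in_H \<eta> \<zeta>
        by (simp add: inner_add inner_scale scale_closed)
      then have "cmod (vinner H \<eta> \<zeta>)
          \<le> cmod (vinner H (s n) (Y \<zeta>)) + cmod (vinner H (vdiff (the (X (s n))) \<eta>) \<zeta>)"
        by (simp add: norm_triangle_ineq4)
      also have "\<dots> \<le> hnorm H (s n) * hnorm H (Y \<zeta>) + hdist H (the (X (s n))) \<eta> * hnorm H \<zeta>"
        unfolding hdist_def using in_H \<eta> \<zeta> Y[OF \<open>\<zeta> \<in> D\<close>]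
        by (intro add_mono inner_bound add_closed scale_closed)
      finally show ?thesis .
    qed
    have "(\<lambda>n. hnorm H (s n) * hnorm H (Y \<zeta>) + hdist H (the (X (s n))) \<eta> * hnorm H \<zeta>)
        \<longlonglongrightarrow> 0 * hnorm H (Y \<zeta>) + 0 * hnorm H \<zeta>"
      by (intro tendsto_intros s0 Xs)
    then have "cmod (vinner H \<eta> \<zeta>) \<le> 0"
      using bound by (intro LIMSEQ_le_const) auto
    then show "vinner H \<zeta> \<eta> = 0" using inner_commute[OF \<eta> \<zeta>] by simp
  qed
qed

lemma hnorm_nonneg:
  assumes "\<xi> \<in> vecs H"
  shows "0 \<le> hnorm H \<xi>"
  using inner_nonneg[OF assms] by (simp add: hnorm_def)

lemma hnorm_scale:
  assumes "\<xi> \<in> vecs H"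
  shows "hnorm H (vscale H c \<xi>) = cmod c * hnorm H \<xi>"
proof -
  have "vinner H (vscale H c \<xi>) (vscale H c \<xi>) = c * cnj c * vinner H \<xi> \<xi>"
    using assms by (simp add: inner_scale inner_scale_right scale_closed)
  also have "\<dots> = of_real ((cmod c * hnorm H \<xi>)\<^sup>2)"
    unfolding complex_norm_square[symmetric] inner_self_real[OF assms]
    by (simp add: power_mult_distrib)
  finally have "hnorm H (vscale H c \<xi>) = sqrt ((cmod c * hnorm H \<xi>)\<^sup>2)"
    unfolding hnorm_def[of H "vscale H c \<xi>"] by (metis Re_complex_of_real)
  then show ?thesis using hnorm_nonneg[OF assms] by simp
qed

lemma hnorm_zero: "hnorm H (vzero H) = 0"
  using inner_add[OF zero_closed zero_closed zero_closed] add_zero[OF zero_closed]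
  by (simp add: hnorm_def)

lemma operator_norm_le:
  assumes X: "hsubspace H (dom X)" and "0 \<le> \<gamma>"
    and bound: "\<And>\<xi>. \<xi> \<in> dom X \<Longrightarrow> hnorm H (the (X \<xi>)) \<le> \<gamma> * hnorm H \<xi>"
  shows "operator_norm H X \<le> \<gamma>"
  unfolding operator_norm_def
proof (rule cSup_least)
  show "{hnorm H (the (X \<xi>)) |\<xi>. \<xi> \<in> dom X \<and> hnorm H \<xi> \<le> 1} \<noteq> {}"
  proof -
    have "vzero H \<in> dom X" "hnorm H (vzero H) \<le> 1"
      using X hnorm_zero by (simp_all add: hsubspace_def)
    then show ?thesis by blast
  qed
  show "r \<le> \<gamma>" if "r \<in> {hnorm H (the (X \<xi>)) |\<xi>. \<xi> \<in> dom X \<and> hnorm H \<xi> \<le> 1}" for r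
    using that bound \<open>0 \<le> \<gamma>\<close> by (auto intro: order_trans mult_left_le)
qed

lemma hnorm_le_operator_norm:
  assumes X: "linear_operator H X" and bounded: "bounded_operator H X" and \<xi>: "\<xi> \<in> dom X"
  shows "hnorm H (the (X \<xi>)) \<le> operator_norm H X * hnorm H \<xi>"
proof -
  obtain C where C: "\<And>\<xi>. \<xi> \<in> dom X \<Longrightarrow> hnorm H (the (X \<xi>)) \<le> C * hnorm H \<xi>"
    using bounded by (auto simp: bounded_operator_def)
  have dom: "\<And>\<xi>. \<xi> \<in> dom X \<Longrightarrow> \<xi> \<in> vecs H" "\<And>c. vscale H c \<xi> \<in> dom X"
    using X \<xi> by (auto simp: linear_operator_def hsubspace_def)
  have Xc: "the (X (vscale H c \<xi>)) = vscale H c (the (X \<xi>))" for c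
    using X \<xi> by (auto simp: linear_operator_def)
  have X\<xi>: "the (X \<xi>) \<in> vecs H"
    using X \<xi> by (auto simp: linear_operator_def ran_def)
  show ?thesis
  proof (cases "hnorm H \<xi> = 0")
    case True
    then show ?thesis using C[OF \<xi>] by simp
  next
    case False
    then have pos: "0 < hnorm H \<xi>" using hnorm_nonneg dom(1)[OF \<xi>] by (simp add: less_le)
    let ?c = "complex_of_real (1 / hnorm H \<xi>)"
    have "bdd_above {hnorm H (the (X \<xi>)) |\<xi>. \<xi> \<in> dom X \<and> hnorm H \<xi> \<le> 1}"
    proof (rule bdd_aboveI)
      fix r assume "r \<in> {hnorm H (the (X \<xi>)) |\<xi>. \<xi> \<in> dom X \<and> hnorm H \<xi> \<le> 1}"
      then obtain \<eta> where \<eta>: "\<eta> \<in> dom X" "hnorm H \<eta> \<le> 1" and r: "r = hnorm H (the (X \<eta>))"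
        by blast
      have "r \<le> C * hnorm H \<eta>" unfolding r by (rule C[OF \<eta>(1)])
      also have "\<dots> \<le> \<bar>C\<bar> * hnorm H \<eta>"
        using hnorm_nonneg[OF dom(1)[OF \<eta>(1)]] by (intro mult_right_mono) auto
      also have "\<dots> \<le> \<bar>C\<bar>" using \<eta>(2) by (intro mult_left_le) auto
      finally show "r \<le> \<bar>C\<bar>" .
    qed
    moreover have "hnorm H (vscale H ?c \<xi>) = 1"
      using pos by (simp add: hnorm_scale dom(1)[OF \<xi>] norm_divide del: of_real_divide)
    ultimately have "hnorm H (the (X (vscale H ?c \<xi>))) \<le> operator_norm H X"
      unfolding operator_norm_def using dom(2)[of ?c] by (intro cSup_upper) auto
    moreover have "hnorm H (the (X (vscale H ?c \<xi>))) = hnorm H (the (X \<xi>)) / hnorm H \<xi>"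
      using pos unfolding Xc by (simp add: hnorm_scale X\<xi> del: of_real_divide)
    ultimately show ?thesis using pos by (simp add: pos_divide_le_eq)
  qed
qed

end


section \<open>The Hilbert space of a positive form\<close>

locale positive_form =
  fixes Q :: "'a::ab_group_add quasi_algebra" and \<phi> :: "'a form"
  assumes vs: "vector_space (smul Q)"
    and sesq: "sesquilinear Q \<phi>"
    and form_real: "Im (\<phi> a a) = 0"
    and form_nonneg: "0 \<le> Re (\<phi> a a)"
begin

sublocale V: vector_space "smul Q" by (rule vs)

abbreviation N where "N \<equiv> form_norm \<phi>"

lemma form_add_left: "\<phi> (a + b) c = \<phi> a c + \<phi> b c"
  and form_scale_left: "\<phi> (smul Q k a) b = k * \<phi> a b"
  and form_add_right: "\<phi> a (b + c) = \<phi> a b + \<phi> a c"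
  and form_scale_right: "\<phi> a (smul Q k b) = cnj k * \<phi> a b"
  using sesq by (simp_all add: sesquilinear_def)

lemma form_zero_left [simp]: "\<phi> 0 a = 0"
  using form_add_left[of 0 0 a] by simp

lemma form_zero_right [simp]: "\<phi> a 0 = 0"
  using form_add_right[of a 0 0] by simp

lemma form_minus_left: "\<phi> (- a) b = - \<phi> a b"
  using form_add_left[of a "- a" b] by (simp add: eq_neg_iff_add_eq_0 add.commute)

lemma form_minus_right: "\<phi> a (- b) = - \<phi> a b"
  using form_add_right[of a b "- b"] by (simp add: eq_neg_iff_add_eq_0 add.commute)

lemma form_diff_left: "\<phi> (a - b) c = \<phi> a c - \<phi> b c"
  using form_add_left[of a "- b" c] by (simp add: form_minus_left)

lemma form_diff_right: "\<phi> a (b - c) = \<phi> a b - \<phi> a c"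
  using form_add_right[of a b "- c"] by (simp add: form_minus_right)

lemma form_self: "\<phi> a a = of_real ((N a)\<^sup>2)"
  using form_real[of a] form_nonneg[of a] by (simp add: form_norm_def complex_eq_iff)

text \<open>Polarization: \<open>\<phi>\<close> is real on the diagonal at \<open>a + b\<close> and at \<open>a + \<i> b\<close>.\<close>

lemma form_commute: "\<phi> b a = cnj (\<phi> a b)"
proof -
  have "Im (\<phi> (a + b) (a + b)) = 0"
    "Im (\<phi> (a + smul Q \<i> b) (a + smul Q \<i> b)) = 0" by (rule form_real)+
  then show ?thesis
    using form_real[of a] form_real[of b]
    by (simp add: form_add_left form_add_right form_scale_left form_scale_right complex_eq_iff)
qed

lemma form_bound: "cmod (\<phi> a b) \<le> N a * N b"
proof -
  have "cmod (\<phi> b a) \<le> sqrt (Re (\<phi> a a)) * sqrt (Re (\<phi> b b))"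
  proof (rule discriminant_bound)
    fix k
    have "0 \<le> Re (\<phi> (a + smul Q k b) (a + smul Q k b))" by (rule form_nonneg)
    also have "\<dots> = Re (\<phi> a a + k * \<phi> b a + cnj (k * \<phi> b a) + k * cnj k * \<phi> b b)"
      by (simp add: form_add_left form_add_right form_scale_left form_scale_right
          form_commute[of b a] algebra_simps)
    also have "\<dots> = Re (\<phi> a a) + 2 * Re (k * \<phi> b a) + (cmod k)\<^sup>2 * Re (\<phi> b b)"
      unfolding complex_norm_square[symmetric] by (simp add: form_real)
    finally show "0 \<le> \<dots>" .
  qed (rule form_nonneg)+
  then show ?thesis
    by (simp add: form_norm_def form_commute[of b a])
qed

lemma N_nonneg [simp]: "0 \<le> N a"
  by (simp add: form_norm_def form_nonneg)

lemma N_zero [simp]: "N 0 = 0"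
  by (simp add: form_norm_def)

lemma N_scale: "N (smul Q c a) = cmod c * N a"
proof -
  have "\<phi> (smul Q c a) (smul Q c a) = c * cnj c * \<phi> a a"
    by (simp add: form_scale_left form_scale_right)
  then show ?thesis
    unfolding complex_norm_square[symmetric] by (simp add: form_norm_def form_real real_sqrt_mult)
qed

lemma N_minus_commute: "N (a - b) = N (b - a)"
  by (simp add: form_norm_def form_diff_left form_diff_right)

lemma N_triangle: "N (a + b) \<le> N a + N b"
proof (rule power2_le_imp_le)
  have "(N (a + b))\<^sup>2 = Re (\<phi> (a + b) (a + b))"
    using form_self[of "a + b"] by (metis Re_complex_of_real)
  also have "\<dots> = (N a)\<^sup>2 + (N b)\<^sup>2 + 2 * Re (\<phi> a b)"
    using form_self[of a] form_self[of b]
    by (simp add: form_add_left form_add_right form_commute[of b a])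
  also have "\<dots> \<le> (N a)\<^sup>2 + (N b)\<^sup>2 + 2 * (N a * N b)"
    using form_bound[of a b] complex_Re_le_cmod[of "\<phi> a b"] by linarith
  finally show "(N (a + b))\<^sup>2 \<le> (N a + N b)\<^sup>2" by (simp add: power2_sum)
qed simp

lemma N_triangle_diff: "N (a - c) \<le> N (a - b) + N (b - c)"
  using N_triangle[of "a - b" "b - c"] by simp

lemma N_diff: "\<bar>N a - N b\<bar> \<le> N (a - b)"
  using N_triangle[of "a - b" b] N_triangle[of "b - a" a] N_minus_commute[of a b] by simp


lemma Cauchy_const: "form_Cauchy \<phi> (\<lambda>n. a)"
  by (auto simp: form_Cauchy_def)

lemma Cauchy_add:
  assumes "form_Cauchy \<phi> s" "form_Cauchy \<phi> t"
  shows "form_Cauchy \<phi> (\<lambda>n. s n + t n)"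
  unfolding form_Cauchy_def
proof (intro allI impI)
  fix \<epsilon> :: real assume "0 < \<epsilon>"
  then obtain N1 N2 where *: "\<And>m n. m \<ge> N1 \<Longrightarrow> n \<ge> N1 \<Longrightarrow> N (s m - s n) < \<epsilon> / 2"
    "\<And>m n. m \<ge> N2 \<Longrightarrow> n \<ge> N2 \<Longrightarrow> N (t m - t n) < \<epsilon> / 2"
    using assms[unfolded form_Cauchy_def] half_gt_zero by meson
  have "N (s m + t m - (s n + t n)) < \<epsilon>" if "m \<ge> max N1 N2" "n \<ge> max N1 N2" for m n
    using N_triangle[of "s m - s n" "t m - t n"] *(1)[of m n] *(2)[of m n] that
    by (simp add: algebra_simps)
  then show "\<exists>K. \<forall>m\<ge>K. \<forall>n\<ge>K. N (s m + t m - (s n + t n)) < \<epsilon>" by blast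
qed

lemma Cauchy_scale:
  assumes "form_Cauchy \<phi> s"
  shows "form_Cauchy \<phi> (\<lambda>n. smul Q c (s n))"
  unfolding form_Cauchy_def
proof (intro allI impI)
  fix \<epsilon> :: real assume "0 < \<epsilon>"
  then have "0 < \<epsilon> / (cmod c + 1)" by (simp add: add_nonneg_pos)
  then obtain K where K: "\<And>m n. m \<ge> K \<Longrightarrow> n \<ge> K \<Longrightarrow> N (s m - s n) < \<epsilon> / (cmod c + 1)"
    using assms[unfolded form_Cauchy_def] by meson
  have "N (smul Q c (s m) - smul Q c (s n)) < \<epsilon>" if "m \<ge> K" "n \<ge> K" for m n
  proof -
    have "N (smul Q c (s m) - smul Q c (s n)) = cmod c * N (s m - s n)"
      by (simp add: N_scale V.scale_right_diff_distrib[symmetric])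
    also have "\<dots> \<le> (cmod c + 1) * N (s m - s n)" by (simp add: mult_right_mono)
    also have "\<dots> < \<epsilon>" using K[OF that] by (simp add: pos_less_divide_eq add_nonneg_pos mult.commute)
    finally show ?thesis .
  qed
  then show "\<exists>K. \<forall>m\<ge>K. \<forall>n\<ge>K. N (smul Q c (s m) - smul Q c (s n)) < \<epsilon>" by blast
qed

lemma Cauchy_minus:
  assumes "form_Cauchy \<phi> s"
  shows "form_Cauchy \<phi> (\<lambda>n. - s n)"
  using Cauchy_scale[OF assms, of "-1"] by simp

lemma N_convergent:
  assumes "form_Cauchy \<phi> s"
  shows "convergent (\<lambda>n. N (s n))"
proof (rule Cauchy_convergent, rule metric_CauchyI)
  fix \<epsilon> :: real assume "0 < \<epsilon>"
  then show "\<exists>K. \<forall>m\<ge>K. \<forall>n\<ge>K. dist (N (s m)) (N (s n)) < \<epsilon>"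
    using assms N_diff unfolding form_Cauchy_def dist_real_def by (meson le_less_trans)
qed

lemma N_bounded:
  assumes "form_Cauchy \<phi> s"
  obtains B where "0 < B" "\<And>n. N (s n) \<le> B"
  using convergent_imp_Bseq[OF N_convergent[OF assms]] by (auto simp: Bseq_def)

lemma form_diff_bound:
  "cmod (\<phi> a b - \<phi> a' b') \<le> N (a - a') * N b + N a' * N (b - b')"
proof -
  have "\<phi> a b - \<phi> a' b' = \<phi> (a - a') b + \<phi> a' (b - b')"
    by (simp add: form_diff_left form_diff_right)
  then show ?thesis
    using norm_triangle_ineq[of "\<phi> (a - a') b" "\<phi> a' (b - b')"]
      form_bound[of "a - a'" b] form_bound[of a' "b - b'"] by simp
qed

text \<open>
  This convergence and \<open>form_tendsto_diff\<close> below make the inner product of two classes of Cauchy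
  sequences exist and independent of the representatives.
\<close>

lemma form_convergent:
  assumes s: "form_Cauchy \<phi> s" and t: "form_Cauchy \<phi> t"
  shows "convergent (\<lambda>n. \<phi> (s n) (t n))"
proof (rule Cauchy_convergent, rule metric_CauchyI)
  fix \<epsilon> :: real assume \<epsilon>: "0 < \<epsilon>"
  obtain A B where A: "0 < A" "\<And>n. N (s n) \<le> A" and B: "0 < B" "\<And>n. N (t n) \<le> B"
    using N_bounded[OF s] N_bounded[OF t] by metis
  have "0 < \<epsilon> / (2 * B)" "0 < \<epsilon> / (2 * A)" using \<epsilon> A B by auto
  then obtain K1 K2 where K: "\<And>m n. m \<ge> K1 \<Longrightarrow> n \<ge> K1 \<Longrightarrow> N (s m - s n) < \<epsilon> / (2 * B)"
    "\<And>m n. m \<ge> K2 \<Longrightarrow> n \<ge> K2 \<Longrightarrow> N (t m - t n) < \<epsilon> / (2 * A)"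
    using s t unfolding form_Cauchy_def by meson
  have "dist (\<phi> (s m) (t m)) (\<phi> (s n) (t n)) < \<epsilon>"
    if "m \<ge> max K1 K2" "n \<ge> max K1 K2" for m n
  proof -
    have "dist (\<phi> (s m) (t m)) (\<phi> (s n) (t n))
        \<le> N (s m - s n) * N (t m) + N (s n) * N (t m - t n)"
      unfolding dist_norm by (rule form_diff_bound)
    also have "\<dots> \<le> N (s m - s n) * B + A * N (t m - t n)"
      using A B by (intro add_mono mult_left_mono mult_right_mono) auto
    also have "\<dots> < \<epsilon> / (2 * B) * B + A * (\<epsilon> / (2 * A))"
      using K that A(1) B(1)
      by (intro add_strict_mono mult_strict_right_mono mult_strict_left_mono) auto
    also have "\<dots> = \<epsilon>" using A(1) B(1) by simp
    finally show ?thesis .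
  qed
  then show "\<exists>K. \<forall>m\<ge>K. \<forall>n\<ge>K. dist (\<phi> (s m) (t m)) (\<phi> (s n) (t n)) < \<epsilon>" by blast
qed

lemma form_tendsto_diff:
  assumes t: "form_Cauchy \<phi> t" and s': "form_Cauchy \<phi> s'"
    and "(\<lambda>n. N (s n - s' n)) \<longlonglongrightarrow> 0" "(\<lambda>n. N (t n - t' n)) \<longlonglongrightarrow> 0"
  shows "(\<lambda>n. \<phi> (s n) (t n) - \<phi> (s' n) (t' n)) \<longlonglongrightarrow> 0"
proof (rule tendsto_zero_comparison)
  show "cmod (\<phi> (s n) (t n) - \<phi> (s' n) (t' n))
      \<le> N (s n - s' n) * N (t n) + N (s' n) * N (t n - t' n)" for n
    by (simp add: form_diff_bound)
  obtain L L' where "(\<lambda>n. N (t n)) \<longlonglongrightarrow> L" "(\<lambda>n. N (s' n)) \<longlonglongrightarrow> L'"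
    using N_convergent[OF t] N_convergent[OF s'] by (auto simp: convergent_def)
  then have "(\<lambda>n. N (s n - s' n) * N (t n) + N (s' n) * N (t n - t' n)) \<longlonglongrightarrow> 0 * L + L' * 0"
    using assms by (intro tendsto_intros)
  then show "(\<lambda>n. N (s n - s' n) * N (t n) + N (s' n) * N (t n - t' n)) \<longlonglongrightarrow> 0" by simp
qed

lemma equiv_form_rel: "equiv {s. form_Cauchy \<phi> s} (form_rel \<phi>)"
proof (rule equivI)
  show "form_rel \<phi> \<subseteq> {s. form_Cauchy \<phi> s} \<times> {s. form_Cauchy \<phi> s}"
    "refl_on {s. form_Cauchy \<phi> s} (form_rel \<phi>)"
    by (auto simp: form_rel_def refl_on_def)
  show "sym (form_rel \<phi>)"
    by (auto simp: form_rel_def sym_def N_minus_commute)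
  show "trans (form_rel \<phi>)"
  proof (rule transI)
    fix r s t assume "(r, s) \<in> form_rel \<phi>" "(s, t) \<in> form_rel \<phi>"
    then have C: "form_Cauchy \<phi> r" "form_Cauchy \<phi> t"
      and lim: "(\<lambda>n. N (r n - s n)) \<longlonglongrightarrow> 0" "(\<lambda>n. N (s n - t n)) \<longlonglongrightarrow> 0"
      by (auto simp: form_rel_def)
    have "(\<lambda>n. N (r n - t n)) \<longlonglongrightarrow> 0"
    proof (rule tendsto_zero_comparison)
      show "norm (N (r n - t n)) \<le> N (r n - s n) + N (s n - t n)" for n
        by (simp add: N_triangle_diff)
      show "(\<lambda>n. N (r n - s n) + N (s n - t n)) \<longlonglongrightarrow> 0"
        using tendsto_add[OF lim] by simp
    qed
    then show "(r, t) \<in> form_rel \<phi>" using C by (simp add: form_rel_def)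
  qed
qed

abbreviation \<H> where "\<H> \<equiv> form_space Q \<phi>"

lemma form_class_eq_iff:
  assumes "form_Cauchy \<phi> s" "form_Cauchy \<phi> t"
  shows "form_class \<phi> s = form_class \<phi> t \<longleftrightarrow> (\<lambda>n. N (s n - t n)) \<longlonglongrightarrow> 0"
  using eq_equiv_class_iff[OF equiv_form_rel, of s t] assms
  by (simp add: form_class_def form_rel_def)

lemma form_class_in_space [simp]: "form_Cauchy \<phi> s \<Longrightarrow> form_class \<phi> s \<in> vecs \<H>"
  by (simp add: form_space_def form_class_def quotientI)

lemma form_space_cases:
  assumes "S \<in> vecs \<H>"
  obtains s where "form_Cauchy \<phi> s" "S = form_class \<phi> s"
  using assms by (auto simp: form_space_def form_class_def elim!: quotientE)

lemma form_rep_class: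
  assumes s: "form_Cauchy \<phi> s"
  shows "form_Cauchy \<phi> (form_rep (form_class \<phi> s))"
    and "(\<lambda>n. N (form_rep (form_class \<phi> s) n - s n)) \<longlonglongrightarrow> 0"
proof -
  have "s \<in> form_class \<phi> s"
    using equiv_class_self[OF equiv_form_rel] s by (simp add: form_class_def)
  then have "form_rep (form_class \<phi> s) \<in> form_class \<phi> s"
    unfolding form_rep_def by (rule someI[of "\<lambda>s'. s' \<in> form_class \<phi> s"])
  then have "(s, form_rep (form_class \<phi> s)) \<in> form_rel \<phi>"
    by (simp add: form_class_def)
  then show "form_Cauchy \<phi> (form_rep (form_class \<phi> s))"
    "(\<lambda>n. N (form_rep (form_class \<phi> s) n - s n)) \<longlonglongrightarrow> 0"
    by (simp_all add: form_rel_def N_minus_commute)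
qed

lemma vzero_form_space: "vzero \<H> = form_class \<phi> (\<lambda>n. 0)"
  by (simp add: form_space_def)

lemma vadd_form_class:
  assumes s: "form_Cauchy \<phi> s" and t: "form_Cauchy \<phi> t"
  shows "vadd \<H> (form_class \<phi> s) (form_class \<phi> t) = form_class \<phi> (\<lambda>n. s n + t n)"
proof -
  let ?s = "form_rep (form_class \<phi> s)" and ?t = "form_rep (form_class \<phi> t)"
  have "(\<lambda>n. N (?s n + ?t n - (s n + t n))) \<longlonglongrightarrow> 0"
  proof (rule tendsto_zero_comparison)
    show "norm (N (?s n + ?t n - (s n + t n))) \<le> N (?s n - s n) + N (?t n - t n)" for n
      using N_triangle[of "?s n - s n" "?t n - t n"] by (simp add: algebra_simps)
    show "(\<lambda>n. N (?s n - s n) + N (?t n - t n)) \<longlonglongrightarrow> 0"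
      using tendsto_add[OF form_rep_class(2)[OF s] form_rep_class(2)[OF t]] by simp
  qed
  then show ?thesis
    using s t by (simp add: form_space_def form_class_eq_iff Cauchy_add form_rep_class)
qed

lemma vscale_form_class:
  assumes s: "form_Cauchy \<phi> s"
  shows "vscale \<H> c (form_class \<phi> s) = form_class \<phi> (\<lambda>n. smul Q c (s n))"
proof -
  have "(\<lambda>n. cmod c * N (form_rep (form_class \<phi> s) n - s n)) \<longlonglongrightarrow> cmod c * 0"
    by (intro tendsto_intros form_rep_class s)
  then show ?thesis
    using s by (simp add: form_space_def form_class_eq_iff Cauchy_scale form_rep_class
        V.scale_right_diff_distrib[symmetric] N_scale)
qed

lemma vinner_form_class:
  assumes s: "form_Cauchy \<phi> s" and t: "form_Cauchy \<phi> t"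
  shows "(\<lambda>n. \<phi> (s n) (t n)) \<longlonglongrightarrow> vinner \<H> (form_class \<phi> s) (form_class \<phi> t)"
proof -
  let ?s = "form_rep (form_class \<phi> s)" and ?t = "form_rep (form_class \<phi> t)"
  have "convergent (\<lambda>n. \<phi> (?s n) (?t n))"
    using s t by (intro form_convergent form_rep_class)
  then have "(\<lambda>n. \<phi> (?s n) (?t n)) \<longlonglongrightarrow> vinner \<H> (form_class \<phi> s) (form_class \<phi> t)"
    by (simp add: form_space_def convergent_LIMSEQ_iff)
  moreover have "(\<lambda>n. \<phi> (?s n) (?t n) - \<phi> (s n) (t n)) \<longlonglongrightarrow> 0"
    using s t by (intro form_tendsto_diff form_rep_class)
  ultimately show ?thesis
    by (rule Lim_transform2)
qed

lemma hnorm_form_class: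
  assumes "form_Cauchy \<phi> s"
  shows "(\<lambda>n. N (s n)) \<longlonglongrightarrow> hnorm \<H> (form_class \<phi> s)"
  unfolding form_norm_def hnorm_def using vinner_form_class[OF assms assms]
  by (intro tendsto_intros)

lemma hdist_form_class:
  assumes s: "form_Cauchy \<phi> s" and t: "form_Cauchy \<phi> t"
  shows "(\<lambda>n. N (s n - t n)) \<longlonglongrightarrow> hdist \<H> (form_class \<phi> s) (form_class \<phi> t)"
  using hnorm_form_class[OF Cauchy_add[OF s Cauchy_scale[OF t, of "-1"]]] s t
  by (simp add: hdist_def vscale_form_class vadd_form_class Cauchy_minus)

lemma form_vec_in_space [simp]: "form_vec \<phi> a \<in> vecs \<H>"
  by (simp add: form_vec_def Cauchy_const)

lemma vadd_form_vec: "vadd \<H> (form_vec \<phi> a) (form_vec \<phi> b) = form_vec \<phi> (a + b)"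
  by (simp add: form_vec_def vadd_form_class Cauchy_const)

lemma vscale_form_vec: "vscale \<H> c (form_vec \<phi> a) = form_vec \<phi> (smul Q c a)"
  by (simp add: form_vec_def vscale_form_class Cauchy_const)

lemma vinner_form_vec: "vinner \<H> (form_vec \<phi> a) (form_vec \<phi> b) = \<phi> a b"
  using vinner_form_class[OF Cauchy_const Cauchy_const, of a b]
  by (simp add: form_vec_def LIMSEQ_const_iff)

lemma hnorm_form_vec: "hnorm \<H> (form_vec \<phi> a) = N a"
  by (simp add: hnorm_def form_norm_def vinner_form_vec)

lemma hdist_form_vec: "hdist \<H> (form_vec \<phi> a) (form_vec \<phi> b) = N (a - b)"
  by (simp add: hdist_def vscale_form_vec vadd_form_vec hnorm_form_vec)

lemma form_vec_eq_iff: "form_vec \<phi> a = form_vec \<phi> b \<longleftrightarrow> N (a - b) = 0"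
  by (simp add: form_vec_def form_class_eq_iff Cauchy_const LIMSEQ_const_iff)

lemma hdist_nonneg:
  assumes "S \<in> vecs \<H>" "T \<in> vecs \<H>"
  shows "0 \<le> hdist \<H> S T"
proof -
  obtain s t where C: "form_Cauchy \<phi> s" "form_Cauchy \<phi> t"
    and eq: "S = form_class \<phi> s" "T = form_class \<phi> t"
    using assms by (metis form_space_cases)
  show ?thesis
    unfolding eq by (rule LIMSEQ_le_const[OF hdist_form_class[OF C]]) simp
qed

lemma hdist_triangle:
  assumes "R \<in> vecs \<H>" "S \<in> vecs \<H>" "T \<in> vecs \<H>"
  shows "hdist \<H> R T \<le> hdist \<H> R S + hdist \<H> S T"
proof -
  obtain r s t where C: "form_Cauchy \<phi> r" "form_Cauchy \<phi> s" "form_Cauchy \<phi> t"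
    and eq: "R = form_class \<phi> r" "S = form_class \<phi> s" "T = form_class \<phi> t"
    using assms by (metis form_space_cases)
  have "(\<lambda>n. N (r n - t n)) \<longlonglongrightarrow> hdist \<H> R T"
    unfolding eq by (intro hdist_form_class C)
  moreover have "(\<lambda>n. N (r n - s n) + N (s n - t n)) \<longlonglongrightarrow> hdist \<H> R S + hdist \<H> S T"
    unfolding eq by (intro tendsto_add hdist_form_class C)
  ultimately show ?thesis
    by (rule LIMSEQ_le) (auto simp: N_triangle_diff)
qed

lemma hdist_commute:
  assumes "S \<in> vecs \<H>" "T \<in> vecs \<H>"
  shows "hdist \<H> S T = hdist \<H> T S"
proof -
  obtain s t where C: "form_Cauchy \<phi> s" "form_Cauchy \<phi> t"
    and eq: "S = form_class \<phi> s" "T = form_class \<phi> t"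
    using assms by (metis form_space_cases)
  show ?thesis
    using hdist_form_class[OF C] hdist_form_class[OF C(2,1)] unfolding eq
    by (subst (asm) N_minus_commute) (rule LIMSEQ_unique)
qed

text \<open>\<open>\<lambda>\<^sub>\<phi>(\<AA>)\<close> is dense in \<open>\<H>\<^sub>\<phi>\<close>: a class is the limit of the entries of any representative.\<close>

lemma form_vec_tendsto:
  assumes x: "form_Cauchy \<phi> x"
  shows "(\<lambda>n. hdist \<H> (form_vec \<phi> (x n)) (form_class \<phi> x)) \<longlonglongrightarrow> 0"
proof (rule LIMSEQ_I)
  fix \<epsilon> :: real assume "0 < \<epsilon>"
  then obtain K where K: "\<And>m n. m \<ge> K \<Longrightarrow> n \<ge> K \<Longrightarrow> N (x m - x n) < \<epsilon> / 2"
    using x half_gt_zero unfolding form_Cauchy_def by meson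
  have "norm (hdist \<H> (form_vec \<phi> (x n)) (form_class \<phi> x) - 0) < \<epsilon>" if "n \<ge> K" for n
  proof -
    have lim: "(\<lambda>m. N (x n - x m)) \<longlonglongrightarrow> hdist \<H> (form_vec \<phi> (x n)) (form_class \<phi> x)"
      unfolding form_vec_def by (intro hdist_form_class Cauchy_const x)
    have "hdist \<H> (form_vec \<phi> (x n)) (form_class \<phi> x) \<le> \<epsilon> / 2"
      using lim K that by (intro LIMSEQ_le_const2) (auto intro: less_imp_le)
    moreover have "0 \<le> hdist \<H> (form_vec \<phi> (x n)) (form_class \<phi> x)"
      using x by (intro hdist_nonneg) auto
    ultimately show ?thesis using \<open>0 < \<epsilon>\<close> by simp
  qed
  then show "\<exists>K. \<forall>n\<ge>K. norm (hdist \<H> (form_vec \<phi> (x n)) (form_class \<phi> x) - 0) < \<epsilon>" by blast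
qed

text \<open>
  Completeness: replace each term of a Cauchy sequence of \<open>\<H>\<close> by an element of \<open>\<AA>\<close> that is
  closer and closer to it. The resulting sequence in \<open>\<AA>\<close> is itself Cauchy, and its class is
  the limit.
\<close>

lemma form_space_complete:
  fixes S :: "nat \<Rightarrow> 'a completion_vec"
  assumes S: "\<And>n. S n \<in> vecs \<H>"
    and Cauchy: "\<forall>\<epsilon>>0. \<exists>K. \<forall>m\<ge>K. \<forall>n\<ge>K. hdist \<H> (S m) (S n) < \<epsilon>"
  shows "\<exists>\<xi>\<in>vecs \<H>. (\<lambda>n. hdist \<H> (S n) \<xi>) \<longlonglongrightarrow> 0"
proof -
  have "\<exists>a. hdist \<H> (form_vec \<phi> a) (S n) < inverse (real (Suc n))" for n
  proof -
    obtain s where s: "form_Cauchy \<phi> s" "S n = form_class \<phi> s"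
      using S by (metis form_space_cases)
    have "\<forall>\<^sub>F k in sequentially. hdist \<H> (form_vec \<phi> (s k)) (S n) < inverse (real (Suc n))"
      unfolding s(2) by (rule order_tendstoD(2)[OF form_vec_tendsto[OF s(1)]]) simp
    then show ?thesis by (auto simp: eventually_sequentially)
  qed
  then obtain x where x: "\<And>n. hdist \<H> (form_vec \<phi> (x n)) (S n) < inverse (real (Suc n))"
    by metis
  have "form_Cauchy \<phi> x"
    unfolding form_Cauchy_def
  proof (intro allI impI)
    fix \<epsilon> :: real assume "0 < \<epsilon>"
    then have \<epsilon>: "0 < \<epsilon> / 3" by simp
    obtain K1 where K1: "\<And>m n. m \<ge> K1 \<Longrightarrow> n \<ge> K1 \<Longrightarrow> hdist \<H> (S m) (S n) < \<epsilon> / 3"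
      using Cauchy \<epsilon> by meson
    obtain K2 where K2: "inverse (real (Suc K2)) < \<epsilon> / 3"
      using reals_Archimedean[OF \<epsilon>] by blast
    have small: "hdist \<H> (form_vec \<phi> (x n)) (S n) < \<epsilon> / 3" if "n \<ge> K2" for n
    proof -
      have "inverse (real (Suc n)) \<le> inverse (real (Suc K2))"
        using that by (intro le_imp_inverse_le) auto
      then show ?thesis using x[of n] K2 by linarith
    qed
    have "N (x m - x n) < \<epsilon>" if "m \<ge> max K1 K2" "n \<ge> max K1 K2" for m n
    proof -
      have "N (x m - x n) \<le> hdist \<H> (form_vec \<phi> (x m)) (S m) + hdist \<H> (S m) (form_vec \<phi> (x n))"
        unfolding hdist_form_vec[symmetric] using S by (intro hdist_triangle) auto
      also have "hdist \<H> (S m) (form_vec \<phi> (x n))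
          \<le> hdist \<H> (S m) (S n) + hdist \<H> (form_vec \<phi> (x n)) (S n)"
        using hdist_triangle[OF S[of m] S[of n] form_vec_in_space[of "x n"]]
          hdist_commute[OF S[of n] form_vec_in_space[of "x n"]] by simp
      finally show ?thesis
        using small[of m] small[of n] K1[of m n] that by simp
    qed
    then show "\<exists>K. \<forall>m\<ge>K. \<forall>n\<ge>K. N (x m - x n) < \<epsilon>" by blast
  qed
  have "(\<lambda>n. hdist \<H> (S n) (form_class \<phi> x)) \<longlonglongrightarrow> 0"
  proof (rule tendsto_zero_comparison)
    have "0 \<le> hdist \<H> (S n) (form_class \<phi> x)" for n
      using S \<open>form_Cauchy \<phi> x\<close> by (intro hdist_nonneg) auto
    moreover have "hdist \<H> (S n) (form_class \<phi> x)
        \<le> inverse (real (Suc n)) + hdist \<H> (form_vec \<phi> (x n)) (form_class \<phi> x)" for n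
      using hdist_triangle[OF S[of n] form_vec_in_space[of "x n"]
          form_class_in_space[OF \<open>form_Cauchy \<phi> x\<close>]]
        hdist_commute[OF S[of n] form_vec_in_space[of "x n"]] x[of n] by simp
    ultimately show "norm (hdist \<H> (S n) (form_class \<phi> x))
        \<le> inverse (real (Suc n)) + hdist \<H> (form_vec \<phi> (x n)) (form_class \<phi> x)" for n
      by simp
    show "(\<lambda>n. inverse (real (Suc n)) + hdist \<H> (form_vec \<phi> (x n)) (form_class \<phi> x)) \<longlonglongrightarrow> 0"
      using tendsto_add[OF LIMSEQ_inverse_real_of_nat form_vec_tendsto[OF \<open>form_Cauchy \<phi> x\<close>]]
      by simp
  qed
  then show ?thesis using \<open>form_Cauchy \<phi> x\<close> by (intro bexI) auto
qed

theorem hilbert_space_form_space: "hilbert_space \<H>"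
proof
  show "vzero \<H> \<in> vecs \<H>"
    by (simp add: vzero_form_space Cauchy_const)
next
  fix \<xi> \<eta> assume "\<xi> \<in> vecs \<H>" "\<eta> \<in> vecs \<H>"
  then obtain s t where st: "form_Cauchy \<phi> s" "\<xi> = form_class \<phi> s"
    "form_Cauchy \<phi> t" "\<eta> = form_class \<phi> t"
    by (metis form_space_cases)
  show "vadd \<H> \<xi> \<eta> \<in> vecs \<H>" "vadd \<H> \<xi> \<eta> = vadd \<H> \<eta> \<xi>"
    using st by (simp_all add: vadd_form_class Cauchy_add add.commute)
  show "vscale \<H> c (vadd \<H> \<xi> \<eta>) = vadd \<H> (vscale \<H> c \<xi>) (vscale \<H> c \<eta>)" for c
    using st by (simp add: vadd_form_class vscale_form_class Cauchy_add Cauchy_scale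
        V.scale_right_distrib)
  have lim: "(\<lambda>n. \<phi> (s n) (t n)) \<longlonglongrightarrow> vinner \<H> \<xi> \<eta>"
    using st by (simp add: vinner_form_class)
  show "vinner \<H> (vscale \<H> c \<xi>) \<eta> = c * vinner \<H> \<xi> \<eta>" for c
  proof (rule LIMSEQ_unique)
    show "(\<lambda>n. \<phi> (smul Q c (s n)) (t n)) \<longlonglongrightarrow> vinner \<H> (vscale \<H> c \<xi>) \<eta>"
      using st by (simp add: vscale_form_class vinner_form_class Cauchy_scale)
    show "(\<lambda>n. \<phi> (smul Q c (s n)) (t n)) \<longlonglongrightarrow> c * vinner \<H> \<xi> \<eta>"
      unfolding form_scale_left by (intro tendsto_intros lim)
  qed
  show "vinner \<H> \<eta> \<xi> = cnj (vinner \<H> \<xi> \<eta>)"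
  proof (rule LIMSEQ_unique)
    show "(\<lambda>n. \<phi> (t n) (s n)) \<longlonglongrightarrow> vinner \<H> \<eta> \<xi>"
      using st by (simp add: vinner_form_class)
    show "(\<lambda>n. \<phi> (t n) (s n)) \<longlonglongrightarrow> cnj (vinner \<H> \<xi> \<eta>)"
      by (subst form_commute) (intro tendsto_intros lim)
  qed
  fix \<zeta> assume "\<zeta> \<in> vecs \<H>"
  then obtain r where r: "form_Cauchy \<phi> r" "\<zeta> = form_class \<phi> r"
    by (metis form_space_cases)
  show "vadd \<H> (vadd \<H> \<xi> \<eta>) \<zeta> = vadd \<H> \<xi> (vadd \<H> \<eta> \<zeta>)"
    using st r by (simp add: vadd_form_class Cauchy_add add.assoc)
  show "vinner \<H> (vadd \<H> \<xi> \<eta>) \<zeta> = vinner \<H> \<xi> \<zeta> + vinner \<H> \<eta> \<zeta>"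
  proof (rule LIMSEQ_unique)
    show "(\<lambda>n. \<phi> (s n + t n) (r n)) \<longlonglongrightarrow> vinner \<H> (vadd \<H> \<xi> \<eta>) \<zeta>"
      using st r by (simp add: vadd_form_class vinner_form_class Cauchy_add)
    show "(\<lambda>n. \<phi> (s n + t n) (r n)) \<longlonglongrightarrow> vinner \<H> \<xi> \<zeta> + vinner \<H> \<eta> \<zeta>"
      unfolding form_add_left using st r by (auto intro!: tendsto_intros vinner_form_class)
  qed
next
  fix \<xi> assume "\<xi> \<in> vecs \<H>"
  then obtain s where s: "form_Cauchy \<phi> s" "\<xi> = form_class \<phi> s"
    by (metis form_space_cases)
  show "vscale \<H> c \<xi> \<in> vecs \<H>" for c
    using s by (simp add: vscale_form_class Cauchy_scale)
  show "vadd \<H> \<xi> (vzero \<H>) = \<xi>"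
    using s by (simp add: vzero_form_space vadd_form_class Cauchy_const)
  show "\<exists>\<eta>\<in>vecs \<H>. vadd \<H> \<xi> \<eta> = vzero \<H>"
    using s by (intro bexI[of _ "vscale \<H> (-1) \<xi>"])
      (simp_all add: vzero_form_space vadd_form_class vscale_form_class Cauchy_minus)
  show "vscale \<H> (c + d) \<xi> = vadd \<H> (vscale \<H> c \<xi>) (vscale \<H> d \<xi>)"
    "vscale \<H> c (vscale \<H> d \<xi>) = vscale \<H> (c * d) \<xi>" "vscale \<H> 1 \<xi> = \<xi>" for c d
    using s by (simp_all add: vadd_form_class vscale_form_class Cauchy_scale V.scale_left_distrib)
  have "(\<lambda>n. Re (\<phi> (s n) (s n))) \<longlonglongrightarrow> Re (vinner \<H> \<xi> \<xi>)"
    using s by (auto intro!: tendsto_intros vinner_form_class)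
  then show "0 \<le> Re (vinner \<H> \<xi> \<xi>)"
    by (rule LIMSEQ_le_const) (auto simp: form_nonneg)
  assume "vinner \<H> \<xi> \<xi> = 0"
  then have "(\<lambda>n. N (s n)) \<longlonglongrightarrow> 0"
    using hnorm_form_class[OF s(1)] s(2) by (simp add: hnorm_def)
  then show "\<xi> = vzero \<H>"
    using s by (simp add: vzero_form_space form_class_eq_iff Cauchy_const)
qed (rule form_space_complete)

sublocale H: hilbert_space \<H> by (rule hilbert_space_form_space)

end


section \<open>The representation induced by a form\<close>

text \<open>
  The construction needs \<open>\<phi>\<close> to be in \<open>\<I>\<close> rather than merely in \<open>\<Q>\<close> for two reasons: \<open>\<lambda>\<^sub>\<phi>(\<AA>\<^sub>0)\<close>
  has to be a dense domain, and density is also what makes left multiplication by an arbitrary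
  element of \<open>\<AA>\<close> well-defined on it.
\<close>

locale induced_representation = quasi_star_algebra Q
  for Q :: "'a::ab_group_add quasi_algebra" +
  fixes \<phi> :: "'a form"
  assumes in_I_forms: "\<phi> \<in> I_forms Q"
begin

sublocale positive_form Q \<phi>
  using in_I_forms vector_space by unfold_locales (auto simp: I_forms_def Q_forms_def vector_space_def)

lemma form_mul_core:
  "\<lbrakk>x \<in> core Q; y \<in> core Q\<rbrakk> \<Longrightarrow> \<phi> (mul Q a x) y = \<phi> x (mul Q (star Q a) y)"
  using in_I_forms by (simp add: I_forms_def Q_forms_def)

definition D where "D = form_vec \<phi> ` core Q"

lemma D_dense: "hdense \<H> D"
  using in_I_forms by (simp add: I_forms_def D_def)

lemma core_dense:
  assumes "0 < \<epsilon>"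
  obtains x where "x \<in> core Q" "N (a - x) < \<epsilon>"
  using D_dense assms form_vec_in_space[of a]
  unfolding hdense_def D_def by (force simp: hdist_form_vec)

text \<open>
  The functional \<open>\<phi>(b, \<cdot>)\<close> has norm \<open>\<parallel>\<lambda>\<^sub>\<phi>(b)\<parallel>\<close>, and a bounded functional has the same norm on
  the dense subspace \<open>\<lambda>\<^sub>\<phi>(\<AA>\<^sub>0)\<close>.
\<close>

lemma N_le_if_core_bound:
  assumes "0 \<le> K" and bound: "\<And>y. y \<in> core Q \<Longrightarrow> cmod (\<phi> b y) \<le> K * N y"
  shows "N b \<le> K"
proof (rule ccontr)
  assume "\<not> N b \<le> K"
  then have gap: "0 < N b - K" and Nb: "0 < N b" using \<open>0 \<le> K\<close> by auto
  \<comment> \<open>Approximating \<open>b\<close> within \<open>\<epsilon>\<close> gives \<open>\<parallel>b\<parallel> (\<parallel>b\<parallel> - K) \<le> \<epsilon> (K + \<parallel>b\<parallel>)\<close>; this \<open>\<epsilon>\<close> makes the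
    right-hand side half of the left-hand side.\<close>
  define \<epsilon> where "\<epsilon> = N b * (N b - K) / (2 * (K + N b))"
  have "0 < \<epsilon>" using gap Nb \<open>0 \<le> K\<close> by (simp add: \<epsilon>_def)
  then obtain y where y: "y \<in> core Q" and close: "N (b - y) < \<epsilon>" by (rule core_dense)
  have "N y \<le> N b + \<epsilon>" using N_diff[of b y] close by linarith
  have "(N b)\<^sup>2 = cmod (\<phi> b b)" by (simp add: form_self norm_power)
  also have "\<phi> b b = \<phi> b y + \<phi> b (b - y)" by (simp add: form_diff_right)
  also have "cmod \<dots> \<le> K * N y + N b * N (b - y)"
    using norm_triangle_ineq[of "\<phi> b y" "\<phi> b (b - y)"] bound[OF y] form_bound[of b "b - y"]
    by linarith
  also have "\<dots> \<le> K * (N b + \<epsilon>) + N b * \<epsilon>"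
    using close \<open>N y \<le> N b + \<epsilon>\<close> \<open>0 \<le> K\<close> by (intro add_mono mult_left_mono) auto
  finally have "N b * (N b - K) \<le> \<epsilon> * (K + N b)"
    by (simp add: algebra_simps power2_eq_square)
  also have "\<dots> = N b * (N b - K) / 2"
  proof -
    have "K + N b \<noteq> 0" using Nb \<open>0 \<le> K\<close> by linarith
    then show ?thesis unfolding \<epsilon>_def by (simp add: divide_simps)
  qed
  finally show False using gap Nb by (simp add: mult_le_0_iff)
qed

lemma core_add: "x \<in> core Q \<Longrightarrow> y \<in> core Q \<Longrightarrow> x + y \<in> core Q"
  and core_scale: "x \<in> core Q \<Longrightarrow> smul Q c x \<in> core Q"
  and core_zero: "0 \<in> core Q"
  and core_diff: "x \<in> core Q \<Longrightarrow> y \<in> core Q \<Longrightarrow> x - y \<in> core Q"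
  using core_subspace V.subspace_add V.subspace_scale V.subspace_0 V.subspace_diff by blast+

text \<open>
  If \<open>x\<close> is null, then \<open>\<phi>(a x, y) = \<phi>(x, a\<^sup>* y) = 0\<close> for all \<open>y\<close> in \<open>\<AA>\<^sub>0\<close>, so \<open>a x\<close> is null as well
  by density.
\<close>

lemma N_mul_core_eq_zero:
  assumes x: "x \<in> core Q" and "N x = 0"
  shows "N (mul Q a x) = 0"
proof -
  have "N (mul Q a x) \<le> 0"
  proof (rule N_le_if_core_bound)
    fix y assume "y \<in> core Q"
    then show "cmod (\<phi> (mul Q a x) y) \<le> 0 * N y"
      using form_bound[of x "mul Q (star Q a) y"] \<open>N x = 0\<close> by (simp add: form_mul_core x)
  qed simp
  then show ?thesis using N_nonneg[of "mul Q a x"] by linarith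
qed

lemma form_vec_mul_cong:
  assumes "x \<in> core Q" "y \<in> core Q" "form_vec \<phi> x = form_vec \<phi> y"
  shows "form_vec \<phi> (mul Q a x) = form_vec \<phi> (mul Q a y)"
proof -
  have "mul Q a x = mul Q a (x - y) + mul Q a y"
    using mul_add_core[of "x - y" y a] assms core_diff by simp
  then have "mul Q a x - mul Q a y = mul Q a (x - y)" by simp
  then show ?thesis
    using assms N_mul_core_eq_zero[of "x - y" a] core_diff by (simp add: form_vec_eq_iff)
qed

text \<open>
  The operator \<open>\<lambda>\<^sub>\<phi>(x) \<mapsto> \<lambda>\<^sub>\<phi>(a x)\<close>; the choice of \<open>x\<close> is immaterial by \<open>form_vec_mul_cong\<close>.
\<close>

definition rep :: "'a \<Rightarrow> 'a completion_vec \<rightharpoonup> 'a completion_vec" where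
  "rep a = (\<lambda>\<xi>. if \<xi> \<in> D
     then Some (form_vec \<phi> (mul Q a (SOME x. x \<in> core Q \<and> \<xi> = form_vec \<phi> x))) else None)"

lemma rep_form_vec:
  assumes x: "x \<in> core Q"
  shows "rep a (form_vec \<phi> x) = Some (form_vec \<phi> (mul Q a x))"
proof -
  let ?x = "SOME x'. x' \<in> core Q \<and> form_vec \<phi> x = form_vec \<phi> x'"
  have "?x \<in> core Q \<and> form_vec \<phi> x = form_vec \<phi> ?x"
    by (rule someI[of "\<lambda>x'. x' \<in> core Q \<and> form_vec \<phi> x = form_vec \<phi> x'" x]) (simp add: x)
  then have "form_vec \<phi> (mul Q a ?x) = form_vec \<phi> (mul Q a x)"
    using form_vec_mul_cong[of ?x x a] x by simp
  then show ?thesis using x by (simp add: rep_def D_def)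
qed

lemma dom_rep: "dom (rep a) = D"
  by (auto simp: rep_def dom_def)

lemma rep_outside: "\<xi> \<notin> D \<Longrightarrow> rep a \<xi> = None"
  by (simp add: rep_def)

lemma ran_rep: "ran (rep a) \<subseteq> vecs \<H>"
  by (auto simp: ran_def rep_def split: if_splits)

lemma D_subspace: "hsubspace \<H> D"
  unfolding hsubspace_def D_def
  by (auto simp: vadd_form_vec vscale_form_vec vzero_form_space form_vec_def[symmetric]
      intro: core_add core_scale core_zero)

lemma linear_rep: "linear_operator \<H> (rep a)"
  unfolding linear_operator_def dom_rep
  using D_subspace ran_rep[of a]
  by (auto simp: D_def vadd_form_vec vscale_form_vec rep_form_vec core_add core_scale
      mul_add_core mul_smul_core)

lemma adjoint_rep:
  assumes y: "y \<in> core Q"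
  shows "adjoint \<H> (rep a) (form_vec \<phi> y) = Some (form_vec \<phi> (mul Q (star Q a) y))"
proof (rule H.adjoint_eqI)
  fix \<xi> assume "\<xi> \<in> dom (rep a)"
  then obtain x where "x \<in> core Q" "\<xi> = form_vec \<phi> x" by (auto simp: dom_rep D_def)
  then show "vinner \<H> (the (rep a \<xi>)) (form_vec \<phi> y)
      = vinner \<H> \<xi> (form_vec \<phi> (mul Q (star Q a) y))"
    by (simp add: rep_form_vec vinner_form_vec form_mul_core y)
qed (use D_dense ran_rep in \<open>simp_all add: dom_rep\<close>)

lemma dagger_rep: "dagger \<H> (rep a) = rep (star Q a)"
proof
  fix \<xi>
  show "dagger \<H> (rep a) \<xi> = rep (star Q a) \<xi>"
  proof (cases "\<xi> \<in> D")
    case True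
    then obtain x where "x \<in> core Q" "\<xi> = form_vec \<phi> x" by (auto simp: D_def)
    then show ?thesis using True by (simp add: dagger_def dom_rep adjoint_rep rep_form_vec)
  next
    case False
    then show ?thesis by (simp add: dagger_def dom_rep rep_outside)
  qed
qed

lemma rep_in_L_dagger: "rep a \<in> L_dagger \<H> D"
proof -
  have D: "D \<subseteq> vecs \<H>" using D_subspace by (simp add: hsubspace_def)
  have "closable \<H> (rep a)"
  proof (rule H.closable_if_formal_adjoint[OF _ ran_rep D_dense])
    fix \<zeta> assume "\<zeta> \<in> D"
    then obtain y where y: "y \<in> core Q" "\<zeta> = form_vec \<phi> y" by (auto simp: D_def)
    then show "the (rep (star Q a) \<zeta>) \<in> vecs \<H>" by (simp add: rep_form_vec)
    fix \<xi> assume "\<xi> \<in> dom (rep a)"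
    then obtain x where "x \<in> core Q" "\<xi> = form_vec \<phi> x" by (auto simp: dom_rep D_def)
    then show "vinner \<H> (the (rep a \<xi>)) \<zeta> = vinner \<H> \<xi> (the (rep (star Q a) \<zeta>))"
      using y by (simp add: rep_form_vec vinner_form_vec form_mul_core)
  qed (use D in \<open>simp add: dom_rep\<close>)
  moreover have "D \<subseteq> dom (adjoint \<H> (rep a))"
    by (auto simp: D_def adjoint_rep)
  ultimately show ?thesis by (simp add: L_dagger_def linear_rep dom_rep)
qed

text \<open>
  For the weak product, \<open>rep x\<close> has to have an adjoint on all vectors \<open>\<lambda>\<^sub>\<phi>(b y)\<close>, which need not lie
  in \<open>D\<close>. The defining property of \<open>\<phi>\<close> only covers second arguments in \<open>\<AA>\<^sub>0\<close>, so \<open>b\<close> is first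
  moved to the left, merged with \<open>x\<close>, and then moved back as \<open>(b\<^sup>* x)\<^sup>* = x\<^sup>* b\<close>.
\<close>

lemma form_core_mul:
  assumes x: "x \<in> core Q" and y: "y \<in> core Q" and z: "z \<in> core Q"
  shows "\<phi> (mul Q x z) (mul Q b y) = \<phi> z (mul Q (star Q x) (mul Q b y))"
proof -
  have "\<phi> (mul Q x z) (mul Q b y) = \<phi> (mul Q (star Q b) (mul Q x z)) y"
    using form_mul_core[of "mul Q x z" y "star Q b"] x y z by (simp add: core_mul star_star)
  also have "\<dots> = \<phi> (mul Q (mul Q (star Q b) x) z) y"
    using x z by (simp add: assoc_right)
  also have "\<dots> = \<phi> z (mul Q (mul Q (star Q x) b) y)"
    using x y z by (simp add: form_mul_core star_mul star_star)
  also have "\<dots> = \<phi> z (mul Q (star Q x) (mul Q b y))"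
    using x y by (simp add: assoc_middle core_star)
  finally show ?thesis .
qed

lemma adjoint_rep_core:
  assumes x: "x \<in> core Q" and y: "y \<in> core Q"
  shows "adjoint \<H> (rep x) (form_vec \<phi> (mul Q b y))
    = Some (form_vec \<phi> (mul Q (star Q x) (mul Q b y)))"
proof (rule H.adjoint_eqI)
  fix \<xi> assume "\<xi> \<in> dom (rep x)"
  then obtain z where "z \<in> core Q" "\<xi> = form_vec \<phi> z" by (auto simp: dom_rep D_def)
  then show "vinner \<H> (the (rep x \<xi>)) (form_vec \<phi> (mul Q b y))
      = vinner \<H> \<xi> (form_vec \<phi> (mul Q (star Q x) (mul Q b y)))"
    by (simp add: rep_form_vec vinner_form_vec form_core_mul x y)
qed (use D_dense ran_rep in \<open>simp_all add: dom_rep\<close>)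

lemma rep_weak_product_defined:
  assumes x: "x \<in> core Q"
  shows "weak_product_defined \<H> D (rep a) (rep x)"
  unfolding weak_product_defined_def dagger_rep
  using x by (auto simp: D_def rep_form_vec adjoint_rep adjoint_rep_core core_mul)

lemma rep_weak_product:
  assumes x: "x \<in> core Q"
  shows "weak_product \<H> (rep a) (rep x) = rep (mul Q a x)"
proof
  fix \<xi>
  show "weak_product \<H> (rep a) (rep x) \<xi> = rep (mul Q a x) \<xi>"
  proof (cases "\<xi> \<in> D")
    case True
    then obtain y where "y \<in> core Q" "\<xi> = form_vec \<phi> y" by (auto simp: D_def)
    then show ?thesis
      using x by (simp add: weak_product_def dagger_rep rep_form_vec adjoint_rep core_mul
          star_star assoc_right)
  next
    case False
    then show ?thesis by (simp add: weak_product_def rep_outside)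
  qed
qed

lemma rep_unit:
  assumes "is_unit_of Q e"
  shows "rep e = Some |` D"
proof
  fix \<xi>
  show "rep e \<xi> = (Some |` D) \<xi>"
  proof (cases "\<xi> \<in> D")
    case True
    then obtain y where "y \<in> core Q" "\<xi> = form_vec \<phi> y" by (auto simp: D_def)
    then show ?thesis using assms True by (simp add: rep_form_vec is_unit_of_def)
  next
    case False
    then show ?thesis by (simp add: rep_outside)
  qed
qed

lemma star_representation_rep: "star_representation Q \<H> D rep"
  unfolding star_representation_def
proof (intro conjI allI ballI impI)
  fix a b c \<xi> assume "\<xi> \<in> D"
  then obtain x where x: "x \<in> core Q" "\<xi> = form_vec \<phi> x" by (auto simp: D_def)
  show "the (rep (a + b) \<xi>) = vadd \<H> (the (rep a \<xi>)) (the (rep b \<xi>))"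
    using x by (simp add: rep_form_vec vadd_form_vec add_mul_core)
  show "the (rep (smul Q c a) \<xi>) = vscale \<H> c (the (rep a \<xi>))"
    using x by (simp add: rep_form_vec vscale_form_vec smul_mul_core)
qed (use hilbert_space_form_space D_subspace D_dense rep_in_L_dagger rep_weak_product_defined
    rep_weak_product rep_unit in \<open>simp_all add: dagger_rep\<close>)

text \<open>The form belonging to the vector \<open>\<lambda>\<^sub>\<phi>(x)\<close> is \<open>\<phi>\<^sup>x\<close>, which a balanced set contains.\<close>

lemma regular_representation_rep:
  assumes M: "balanced Q M" "\<phi> \<in> M"
  shows "regular_representation Q M \<H> D rep"
  unfolding regular_representation_def
proof (intro conjI ballI star_representation_rep)
  fix \<xi> assume "\<xi> \<in> D"
  then obtain x where x: "x \<in> core Q" "\<xi> = form_vec \<phi> x" by (auto simp: D_def)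
  then have "(\<lambda>a b. vinner \<H> (the (rep a \<xi>)) (the (rep b \<xi>))) = form_shift Q \<phi> x"
    by (simp add: rep_form_vec vinner_form_vec form_shift_def)
  then show "(\<lambda>a b. vinner \<H> (the (rep a \<xi>)) (the (rep b \<xi>))) \<in> M"
    using M x by (simp add: balanced_def)
qed

lemma form_le_operator_norm:
  assumes "bounded_operator \<H> (rep a)" and x: "x \<in> core Q"
  shows "cmod (\<phi> (mul Q a x) y) \<le> operator_norm \<H> (rep a) * N x * N y"
proof -
  have "N (mul Q a x) \<le> operator_norm \<H> (rep a) * N x"
    using H.hnorm_le_operator_norm[OF linear_rep assms(1), of "form_vec \<phi> x"] x
    by (simp add: dom_rep D_def rep_form_vec hnorm_form_vec)
  then have "N (mul Q a x) * N y \<le> operator_norm \<H> (rep a) * N x * N y"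
    by (intro mult_right_mono) auto
  then show ?thesis using form_bound[of "mul Q a x" y] by linarith
qed

end


section \<open>Bounded elements and regular representations\<close>

text \<open>
  For \<open>\<phi> = \<phi>\<^sub>\<xi>\<close> the seminorms of \<open>a\<close> and \<open>e\<close> are \<open>\<parallel>\<pi>(a)\<xi>\<parallel>\<close> and \<open>\<parallel>\<xi>\<parallel>\<close>, so the estimate is an instance of
  \<open>N_le_if_core_bound\<close>.
\<close>

lemma regular_representation_bound:
  assumes Q: "quasi_star_algebra Q" and e: "is_unit_of Q e" and M: "M \<subseteq> I_forms Q"
    and \<gamma>: "\<gamma> \<in> form_bounds Q M a"
    and \<pi>: "regular_representation Q M H D \<pi>" and \<xi>: "\<xi> \<in> D"
  shows "hnorm H (the (\<pi> a \<xi>)) \<le> \<gamma> * hnorm H \<xi>"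
proof -
  define \<phi> where "\<phi> = (\<lambda>a b. vinner H (the (\<pi> a \<xi>)) (the (\<pi> b \<xi>)))"
  have "\<phi> \<in> M"
    using \<pi> \<xi> by (simp add: regular_representation_def \<phi>_def)
  then interpret induced_representation Q \<phi>
    using Q M by (intro induced_representation.intro induced_representation_axioms.intro) auto
  have norm: "form_norm \<phi> b = hnorm H (the (\<pi> b \<xi>))" for b
    by (simp add: form_norm_def hnorm_def \<phi>_def)
  have "\<pi> e = Some |` D"
    using \<pi> e by (simp add: regular_representation_def star_representation_def)
  then have norm_e: "form_norm \<phi> e = hnorm H \<xi>"
    using \<xi> by (simp add: norm)
  have "form_norm \<phi> a \<le> \<gamma> * form_norm \<phi> e"
  proof (rule N_le_if_core_bound)
    show "0 \<le> \<gamma> * form_norm \<phi> e" using \<gamma> by (simp add: form_bounds_def)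
    fix y assume "y \<in> core Q"
    then have "cmod (\<phi> (mul Q a e) y) \<le> \<gamma> * form_norm \<phi> e * form_norm \<phi> y"
      using \<gamma> \<open>\<phi> \<in> M\<close> e unfolding form_bounds_def form_norm_def is_unit_of_def by blast
    then show "cmod (\<phi> a y) \<le> \<gamma> * form_norm \<phi> e * form_norm \<phi> y"
      using e by (simp add: is_unit_of_def)
  qed
  then show ?thesis by (simp add: norm_e) (simp add: norm)
qed

theorem proposition4p14:
  fixes Q :: "'a::ab_group_add quasi_algebra"
    and M :: "'a form set"
    and e a :: 'a
  assumes "quasi_star_algebra Q"
    and "is_unit_of Q e"
    and "M \<subseteq> I_forms Q"
    and "sufficient Q M"
  shows "(a \<in> bounded_elements Q M \<longrightarrow>
           (\<forall>(H :: 'h inner_space) D \<pi>. regular_representation Q M H D \<pi> \<longrightarrow>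
              bounded_operator H (\<pi> a) \<and> operator_norm H (\<pi> a) \<le> bounded_norm Q M a))
       \<and> ((\<forall>(H :: 'a completion_vec inner_space) D \<pi>. regular_representation Q M H D \<pi> \<longrightarrow>
              bounded_operator H (\<pi> a)) \<and>
          bdd_above {r. \<exists>(H :: 'a completion_vec inner_space) D \<pi>.
              regular_representation Q M H D \<pi> \<and> r = operator_norm H (\<pi> a)}
          \<longrightarrow> a \<in> bounded_elements Q M)"
proof (intro conjI impI allI)
  fix H :: "'h inner_space" and D \<pi>
  assume a: "a \<in> bounded_elements Q M" and \<pi>: "regular_representation Q M H D \<pi>"
  interpret hilbert_space H
    using \<pi> by (simp add: regular_representation_def star_representation_def)
  have D: "hsubspace H D" "dom (\<pi> a) = D"
    using \<pi> by (auto simp: regular_representation_def star_representation_def L_dagger_def)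
  have bound: "hnorm H (the (\<pi> a \<xi>)) \<le> \<gamma> * hnorm H \<xi>"
    if "\<gamma> \<in> form_bounds Q M a" "\<xi> \<in> dom (\<pi> a)" for \<gamma> \<xi>
    using regular_representation_bound[OF assms(1-3) that(1) \<pi>] that(2) D(2) by simp
  have nonempty: "form_bounds Q M a \<noteq> {}" using a by (simp add: bounded_elements_def)
  then show "bounded_operator H (\<pi> a)"
    using bound unfolding bounded_operator_def by blast
  show "operator_norm H (\<pi> a) \<le> bounded_norm Q M a"
    unfolding bounded_norm_def
  proof (rule cInf_greatest[OF nonempty])
    fix \<gamma> assume \<gamma>: "\<gamma> \<in> form_bounds Q M a"
    then have "0 \<le> \<gamma>" by (simp add: form_bounds_def)
    then show "operator_norm H (\<pi> a) \<le> \<gamma>"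
      using D bound[OF \<gamma>] by (intro operator_norm_le) auto
  qed
next
  assume hyp: "(\<forall>(H :: 'a completion_vec inner_space) D \<pi>. regular_representation Q M H D \<pi> \<longrightarrow>
              bounded_operator H (\<pi> a)) \<and>
          bdd_above {r. \<exists>(H :: 'a completion_vec inner_space) D \<pi>.
              regular_representation Q M H D \<pi> \<and> r = operator_norm H (\<pi> a)}" (is "_ \<and> bdd_above ?norms")
  then have "bdd_above ?norms" by (rule conjunct2)
  then obtain C where norms: "\<forall>r\<in>?norms. r \<le> C"
    unfolding bdd_above_def by (rule exE)
  have C: "operator_norm H (\<pi> a) \<le> C" if "regular_representation Q M H D \<pi>"
    for H :: "'a completion_vec inner_space" and D \<pi>
    using norms that by blast
  \<comment> \<open>Elements of \<open>form_bounds\<close> are positive, but \<open>C\<close> need not be.\<close>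
  have "max C 1 \<in> form_bounds Q M a"
    unfolding form_bounds_def
  proof (intro CollectI conjI ballI)
    fix \<phi> x y assume \<phi>: "\<phi> \<in> M" and x: "x \<in> core Q" and "y \<in> core Q"
    interpret induced_representation Q \<phi>
      using assms(1,3) \<phi> by (intro induced_representation.intro induced_representation_axioms.intro) auto
    have regular: "regular_representation Q M \<H> D rep"
      using assms(4) \<phi> by (intro regular_representation_rep) (simp add: sufficient_def)
    then have "cmod (\<phi> (mul Q a x) y) \<le> operator_norm \<H> (rep a) * N x * N y"
      using hyp x by (intro form_le_operator_norm) auto
    also have "\<dots> \<le> max C 1 * N x * N y"
      using C[OF regular] by (intro mult_right_mono) auto
    finally show "cmod (\<phi> (mul Q a x) y) \<le> max C 1 * sqrt (Re (\<phi> x x)) * sqrt (Re (\<phi> y y))"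
      by (simp add: form_norm_def)
  qed simp
  then show "a \<in> bounded_elements Q M" by (auto simp: bounded_elements_def)
qed

end
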